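(* Let $\overline{\mathcal G}$ be the group of interval exchange transformations with flips of $[0,1)$ (modulo equality outside finite sets), and let $c(\overline{\mathcal G})$ be the supremum of the commutator lengths of the elements of $[\overline{\mathcal G},\overline{\mathcal G}]$. Then $c(\overline{\mathcal G})\leq 6$.
   Context: Let $I=[0,1)$. An interval exchange transformation with flips (FIET) on $I$ is a bijection $f:I\to I$ for which there is a subdivision $0=a_1<\cdots<a_m<a_{m+1}=1$ such that each restriction $f|_{(a_i,a_{i+1})}$ is a continuous isometry (orientation preserving or orientation reversing). Two FIET $f,g$ are equivalent if $\{x\in I: f(x)\neq g(x)\}$ is finite. $\overline{\mathcal G}$ denotes the group of equivalence classes of FIET on $I$ under composition (the quotient of the FIET group by the normal subgroup of elements that are the identity except possibly at finitely many points). For a group $G$, a commutator is an element $[f,g]=fgf^{-1}g^{-1}$ with $f,g\in G$, and $[G,G]$ is the subgroup generated by commutators. For $g\in[G,G]$, the commutator length $c_G(g)$ is the least number $c$ such that $g$ is a product of $c$ commutators of $G$, and $c(G)=\sup\{c_G(g): g\in[G,G]\}$. (The group $\overline{\mathcal G}$ is known to be perfect, i.e. $[\overline{\mathcal G},\overline{\mathcal G}]=\overline{\mathcal G}$.) *)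

theory Defs
  imports "HOL-Analysis.Analysis" "HOL-Algebra.Bij" "HOL-Algebra.Generated_Groups"
begin

section \<open>Interval exchange transformations with flips\<close>

abbreviation unit_Ico :: "real set" where
  "unit_Ico \<equiv> {0..<1}"

text \<open>Continuity on the open pieces is not listed separately: it follows from the isometry
  condition. The case \<open>m = 0\<close> is excluded by \<open>a 1 \<noteq> a (m + 1)\<close>.\<close>

definition is_FIET :: "(real \<Rightarrow> real) \<Rightarrow> bool" where
  "is_FIET f \<longleftrightarrow> bij_betw f unit_Ico unit_Ico \<and>
     (\<exists>(m::nat) (a :: nat \<Rightarrow> real). a 1 = 0 \<and> a (m + 1) = 1 \<and>
        (\<forall>i\<in>{1..m}. a i < a (i + 1)) \<and>
        (\<forall>i\<in>{1..m}. \<forall>x\<in>{a i<..<a (i + 1)}. \<forall>y\<in>{a i<..<a (i + 1)}.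
            dist (f x) (f y) = dist x y))"

text \<open>Maps are represented by functions extensional on \<open>[0,1)\<close>, as in \<^const>\<open>BijGroup\<close>.\<close>

definition FIET_group :: "(real \<Rightarrow> real) monoid" where
  "FIET_group = BijGroup unit_Ico \<lparr>carrier := {f \<in> Bij unit_Ico. is_FIET f}\<rparr>"

definition FIET_finsupp :: "(real \<Rightarrow> real) set" where
  "FIET_finsupp = {f \<in> carrier FIET_group. finite {x \<in> unit_Ico. f x \<noteq> x}}"

definition FIET_bar :: "(real \<Rightarrow> real) set monoid" where
  "FIET_bar = FIET_group Mod FIET_finsupp"

section \<open>Commutator length\<close>

text \<open>The elements of \<open>derived_set G (carrier G)\<close> are the commutators
  \<open>f g f\<inverse> g\<inverse>\<close> of \<open>G\<close>. The value is \<open>\<infinity>\<close> if \<open>g\<close> is not a product of commutators;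
  the unit has length 0 (empty product).\<close>

definition commutator_length :: "('a, 'b) monoid_scheme \<Rightarrow> 'a \<Rightarrow> enat" where
  "commutator_length G g =
     Inf {enat (length cs) |cs. set cs \<subseteq> derived_set G (carrier G) \<and>
                                g = foldr (\<otimes>\<^bsub>G\<^esub>) cs \<one>\<^bsub>G\<^esub>}"

definition commutator_width :: "('a, 'b) monoid_scheme \<Rightarrow> enat" where
  "commutator_width G = (SUP g \<in> derived G (carrier G). commutator_length G g)"

section \<open>Group structure\<close>

lemma is_FIET_iff:
  "is_FIET f \<longleftrightarrow> bij_betw f unit_Ico unit_Ico \<and>
     (\<exists>S. finite S \<and> (\<forall>x\<in>unit_Ico. \<forall>y\<in>unit_Ico. closed_segment x y \<inter> S = {} \<longrightarrow>
        dist (f x) (f y) = dist x y))" (is "_ \<longleftrightarrow> _ \<and> (\<exists>S. ?P S)")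
proof safe
  assume "is_FIET f"
  then show "bij_betw f unit_Ico unit_Ico" by (simp add: is_FIET_def)
  from \<open>is_FIET f\<close> obtain m and a :: "nat \<Rightarrow> real" where a: "a 1 = 0" "a (m + 1) = 1"
     "\<forall>i\<in>{1..m}. a i < a (i + 1)"
     "\<And>i x y. i \<in> {1..m} \<Longrightarrow> x\<in>{a i<..<a (i + 1)} \<Longrightarrow> y\<in>{a i<..<a (i + 1)} \<Longrightarrow>
            dist (f x) (f y) = dist x y"
    unfolding is_FIET_def by metis
  let ?S = "a ` {1..m+1}"
  have *: "dist (f x) (f y) = dist x y"
    if xy: "x \<in> unit_Ico" "y \<in> unit_Ico" "x \<le> y" "{x..y} \<inter> ?S = {}" for x y
  proof -
    define k where "k = (LEAST k. k \<ge> 1 \<and> x < a k)"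
    have k: "k \<ge> 1" "x < a k" and kle: "k \<le> m + 1"
      using LeastI[of "\<lambda>k. k \<ge> 1 \<and> x < a k" "m + 1"] Least_le[of "\<lambda>k. k \<ge> 1 \<and> x < a k" "m + 1"]
        a(2) xy(1) by (auto simp: k_def)
    have "k \<noteq> 1" using k a(1) xy(1) by auto
    with k have k2: "k - 1 \<in> {1..m}" "k - 1 + 1 = k" using kle by auto
    have "\<not> (x < a (k - 1))"
      using not_less_Least[of "k - 1" "\<lambda>k. k \<ge> 1 \<and> x < a k"] k2 by (auto simp: k_def)
    moreover have "a (k - 1) \<in> ?S" "a k \<in> ?S" using k2 kle k by auto
    ultimately have "a (k - 1) < x" "y < a k"
      using xy(3,4) k(2) by (meson atLeastAtMost_iff disjoint_iff less_imp_le not_less order_trans)+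
    then show ?thesis using a(4)[OF k2(1), of x y] k2(2) xy(3) by auto
  qed
  have "?P ?S"
  proof (intro conjI ballI impI)
    fix x y assume xy: "x \<in> unit_Ico" "y \<in> unit_Ico" "closed_segment x y \<inter> ?S = {}"
    show "dist (f x) (f y) = dist x y"
      using *[of x y] *[of y x] xy
      by (cases "x \<le> y") (auto simp: closed_segment_eq_real_ivl dist_commute split: if_splits)
  qed auto
  then show "\<exists>S. ?P S" by blast
next
  fix S assume bij: "bij_betw f unit_Ico unit_Ico" and fin: "finite S"
    and S: "\<forall>x\<in>unit_Ico. \<forall>y\<in>unit_Ico. closed_segment x y \<inter> S = {} \<longrightarrow>
        dist (f x) (f y) = dist x y"
  define T where "T = insert 0 (insert 1 (S \<inter> {0..1}))"
  have T: "finite T" "0 \<in> T" "1 \<in> T" "T \<subseteq> {0..1}" using fin by (auto simp: T_def)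
  define L where "L = sorted_list_of_set T"
  have L: "set L = T" "sorted_wrt (<) L" using T(1) by (auto simp: L_def)
  have len: "length L \<ge> 2"
    using card_mono[of T "{0,1}"] T by (simp add: L_def)
  have nth_mono: "L ! i < L ! j" if "i < j" "j < length L" for i j
    using L(2) that by (simp add: sorted_wrt_iff_nth_less)
  have nth_mono': "L ! i \<le> L ! j" if "i \<le> j" "j < length L" for i j
    using nth_mono[of i j] that by (cases "i = j") auto
  have nth_mem: "L ! i \<in> T" if "i < length L" for i using L(1) that nth_mem by blast
  define a where "a i = L ! (i - 1)" for i
  define m where "m = length L - 1"
  show "is_FIET f"
    unfolding is_FIET_def
  proof (intro conjI exI[of _ m] exI[of _ a] ballI)
    obtain i where i: "i < length L" "L ! i = 0" using T(2) L(1) by (metis in_set_conv_nth)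
    have "L ! 0 \<le> L ! i" "0 \<le> L ! 0" using nth_mono'[of 0 i] i nth_mem[of 0] T(4) len by force+
    then show "a 1 = 0" using i by (simp add: a_def)
    obtain i where i: "i < length L" "L ! i = 1" using T(3) L(1) by (metis in_set_conv_nth)
    have "L ! i \<le> L ! m" "L ! m \<le> 1" using nth_mono'[of i m] i nth_mem[of m] T(4) len by (force simp: m_def)+
    then show "a (m + 1) = 1" using i by (simp add: a_def)
    fix i assume i: "i \<in> {1..m}"
    show "a i < a (i + 1)" using nth_mono[of "i - 1" i] i by (auto simp: a_def m_def)
    fix x y assume xy: "x \<in> {a i<..<a (i + 1)}" "y \<in> {a i<..<a (i + 1)}"
    have ai: "a i \<ge> 0" "a (i + 1) \<le> 1"
      using nth_mem[of "i - 1"] nth_mem[of i] i T(4) by (force simp: a_def m_def)+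
    have dis: "z \<notin> T" if z: "z \<in> {a i<..<a (i + 1)}" for z
    proof
      assume "z \<in> T"
      then obtain j where j: "j < length L" "z = L ! j" using L(1) by (metis in_set_conv_nth)
      have "j < length L" "i < length L" "i \<ge> 1" using j i by (auto simp: m_def)
      moreover have "j \<le> i - 1 \<or> i \<le> j" by linarith
      moreover have "L ! (i - 1) < L ! j" "L ! j < L ! i" using z j by (auto simp: a_def)
      ultimately show False
        using nth_mono'[of j "i - 1"] nth_mono'[of i j] by linarith
    qed
    have "closed_segment x y \<subseteq> {a i<..<a (i + 1)}"
      using xy by (auto simp: closed_segment_eq_real_ivl split: if_splits)
    moreover have "z \<notin> S" if "z \<in> {a i<..<a (i + 1)}" for z
      using dis[OF that] that ai by (simp add: T_def)
    ultimately have "closed_segment x y \<inter> S = {}" by blast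
    then show "dist (f x) (f y) = dist x y" using S xy ai by auto
  qed (rule bij)
qed

lemma continuous_on_local_isometry:
  fixes f :: "real \<Rightarrow> real"
  assumes S: "finite S"
    "\<And>x y. x \<in> unit_Ico \<Longrightarrow> y \<in> unit_Ico \<Longrightarrow> closed_segment x y \<inter> S = {} \<Longrightarrow> dist (f x) (f y) = dist x y"
  shows "continuous_on ({0<..<1} - S) f"
proof (rule continuous_at_imp_continuous_on, rule ballI)
  fix x assume x: "x \<in> {0<..<1} - S"
  have "open ({0<..<1} - S)" using S(1) by (simp add: finite_imp_closed open_Diff)
  with x obtain e where e: "e > 0" "ball x e \<subseteq> {0<..<1} - S" by (meson open_contains_ball)
  have iso: "dist (f x) (f y) = dist x y" if "y \<in> ball x e" for y
  proof -
    have "closed_segment x y \<subseteq> ball x e" using that e(1) by (simp add: closed_segment_subset)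
    then show ?thesis using S(2)[of x y] e x that by fastforce
  qed
  show "isCont f x"
    unfolding continuous_at_eps_delta
  proof safe
    fix r :: real assume "r > 0"
    then show "\<exists>d>0. \<forall>y. dist y x < d \<longrightarrow> dist (f y) (f x) < r"
      using iso e(1) by (intro exI[of _ "min e r"]) (auto simp: dist_commute)
  qed
qed

lemma is_FIET_compose:
  assumes f: "is_FIET f" and g: "is_FIET g"
  shows "is_FIET (compose unit_Ico g f)"
proof -
  obtain S where S: "finite S"
    "\<And>x y. x \<in> unit_Ico \<Longrightarrow> y \<in> unit_Ico \<Longrightarrow> closed_segment x y \<inter> S = {} \<Longrightarrow> dist (f x) (f y) = dist x y"
    using f unfolding is_FIET_iff by metis
  obtain T where T: "finite T"
    "\<And>x y. x \<in> unit_Ico \<Longrightarrow> y \<in> unit_Ico \<Longrightarrow> closed_segment x y \<inter> T = {} \<Longrightarrow> dist (g x) (g y) = dist x y"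
    using g unfolding is_FIET_iff by metis
  have bf: "bij_betw f unit_Ico unit_Ico" and bg: "bij_betw g unit_Ico unit_Ico"
    using f g by (auto simp: is_FIET_def)
  let ?U = "insert 0 (S \<union> {x \<in> unit_Ico. f x \<in> T})"
  have "finite {x \<in> unit_Ico. f x \<in> T}"
    using finite_vimage_IntI[OF T(1) bij_betw_imp_inj_on[OF bf]]
    by (rule rev_finite_subset) auto
  then have "finite ?U" using S(1) by simp
  moreover have "dist (compose unit_Ico g f x) (compose unit_Ico g f y) = dist x y"
    if xy: "x \<in> unit_Ico" "y \<in> unit_Ico" "closed_segment x y \<inter> ?U = {}" for x y
  proof -
    have seg: "closed_segment x y \<subseteq> {0<..<1} - S"
    proof
      fix z assume z: "z \<in> closed_segment x y"
      then have "z \<in> unit_Ico" using xy(1,2) by (auto simp: closed_segment_eq_real_ivl split: if_splits)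
      then show "z \<in> {0<..<1} - S" using z xy(3) by (cases "z = 0") auto
    qed
    then have "connected (f ` closed_segment x y)"
      by (intro connected_continuous_image continuous_on_subset[OF continuous_on_local_isometry[OF S]]) auto
    then have "closed_segment (f x) (f y) \<subseteq> f ` closed_segment x y"
      by (intro closed_segment_subset) (auto simp: is_interval_connected_1 simp flip: is_interval_convex_1)
    moreover have "f z \<notin> T" if "z \<in> closed_segment x y" for z
    proof -
      have "z \<in> unit_Ico" using seg that by force
      then show ?thesis using xy(3) that by blast
    qed
    ultimately have "closed_segment (f x) (f y) \<inter> T = {}" by blast
    moreover have "f x \<in> unit_Ico" "f y \<in> unit_Ico"
      using bij_betwE[OF bf] xy(1,2) by blast+
    ultimately show ?thesis using T(2)[of "f x" "f y"] S(2)[of x y] xy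
      by (simp add: compose_eq del: atLeastLessThan_iff) blast
  qed
  moreover have "bij_betw (compose unit_Ico g f) unit_Ico unit_Ico"
    using bf bg by (rule bij_betw_compose)
  ultimately show ?thesis unfolding is_FIET_iff by blast
qed

lemma is_FIET_inv:
  assumes f: "is_FIET f"
  shows "is_FIET (restrict (inv_into unit_Ico f) unit_Ico)"
proof -
  obtain S where S: "finite S"
    "\<And>x y. x \<in> unit_Ico \<Longrightarrow> y \<in> unit_Ico \<Longrightarrow> closed_segment x y \<inter> S = {} \<Longrightarrow> dist (f x) (f y) = dist x y"
    using f unfolding is_FIET_iff by metis
  have bf: "bij_betw f unit_Ico unit_Ico" using f by (auto simp: is_FIET_def)
  let ?g = "inv_into unit_Ico f"
  let ?W = "{0<..<1} - S"
  have inj: "inj_on f ?W"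
    using bij_betw_imp_inj_on[OF bf] by (rule inj_on_subset) auto
  have "open ?W" using S(1) by (simp add: finite_imp_closed open_Diff)
  then obtain h where h: "homeomorphism ?W (f ` ?W) f h"
    using invariance_of_domain_homeomorphism[OF _ continuous_on_local_isometry[OF S] order_refl inj]
    by blast
  let ?T = "f ` insert 0 (S \<inter> unit_Ico)"
  have "dist (?g u) (?g v) = dist u v"
    if uv: "u \<in> unit_Ico" "v \<in> unit_Ico" "closed_segment u v \<inter> ?T = {}" for u v
  proof -
    have seg: "z \<in> unit_Ico \<and> ?g z \<in> ?W \<and> f (?g z) = z \<and> z \<in> f ` ?W \<and> h z = ?g z" if z: "z \<in> closed_segment u v" for z
    proof -
      have zI: "z \<in> unit_Ico" using z uv(1,2) by (auto simp: closed_segment_eq_real_ivl split: if_splits)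
      have "z \<in> f ` unit_Ico" using zI bf by (simp add: bij_betw_def)
      then have fg: "f (?g z) = z" "?g z \<in> unit_Ico"
        by (rule f_inv_into_f, rule inv_into_into)
      have "?g z \<notin> insert 0 (S \<inter> unit_Ico)" using uv(3) z fg(1) by (metis IntI empty_iff imageI)
      then have W: "?g z \<in> ?W" using fg(2) by auto
      then have "h z = ?g z" using h fg(1) by (metis homeomorphism_apply1)
      then show ?thesis using W fg zI by (metis imageI)
    qed
    have "connected (h ` closed_segment u v)"
      using seg by (intro connected_continuous_image continuous_on_subset[OF homeomorphism_cont2[OF h]]) auto
    then have "closed_segment (?g u) (?g v) \<subseteq> h ` closed_segment u v"
      using seg by (intro closed_segment_subset) (auto simp: is_interval_connected_1 image_iff simp flip: is_interval_convex_1 intro: bexI[of _ u] bexI[of _ v])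
    also have "\<dots> \<subseteq> ?W" using seg by force
    finally have "closed_segment (?g u) (?g v) \<inter> S = {}" by auto
    with S(2)[of "?g u" "?g v"] seg[of u] seg[of v] show ?thesis by auto
  qed
  moreover have "finite ?T" using S(1) by simp
  moreover have "bij_betw (restrict ?g unit_Ico) unit_Ico unit_Ico"
    using bij_betw_inv_into[OF bf] by (simp add: bij_betw_restrict_eq)
  ultimately show ?thesis unfolding is_FIET_iff by (intro conjI exI[of _ ?T]) auto
qed

lemma subgroup_FIET: "subgroup {f \<in> Bij unit_Ico. is_FIET f} (BijGroup unit_Ico)"
proof (intro group.subgroupI group_BijGroup)
  have "is_FIET (\<lambda>x\<in>unit_Ico. x)"
    unfolding is_FIET_iff using bij_betw_id[of unit_Ico]
    by (auto simp: id_def intro: exI[of _ "{}"])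
  then show "{f \<in> Bij unit_Ico. is_FIET f} \<noteq> {}" using id_Bij by blast
qed (auto simp: BijGroup_def is_FIET_compose compose_Bij is_FIET_inv restrict_inv_into_Bij
       inv_BijGroup[unfolded BijGroup_def])

lemma group_FIET_group: "group FIET_group"
  using subgroup.subgroup_is_group[OF subgroup_FIET group_BijGroup] by (simp add: FIET_group_def)

lemma FIET_group_simps:
  "carrier FIET_group = {f \<in> Bij unit_Ico. is_FIET f}"
  "\<one>\<^bsub>FIET_group\<^esub> = (\<lambda>x\<in>unit_Ico. x)"
  "g \<in> carrier FIET_group \<Longrightarrow> f \<in> carrier FIET_group \<Longrightarrow>
     g \<otimes>\<^bsub>FIET_group\<^esub> f = compose unit_Ico g f"
  by (auto simp: FIET_group_def BijGroup_def)

lemma FIET_group_inv: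
  assumes "f \<in> carrier FIET_group"
  shows "inv\<^bsub>FIET_group\<^esub> f = restrict (inv_into unit_Ico f) unit_Ico"
  using group.m_inv_consistent[OF group_BijGroup subgroup_FIET, of f] assms
  by (simp add: FIET_group_def BijGroup_def[of unit_Ico] inv_BijGroup[unfolded BijGroup_def])

lemma FIET_mult_inv_in_finsupp_iff:
  assumes f: "f \<in> carrier FIET_group" and g: "g \<in> carrier FIET_group"
  shows "f \<otimes>\<^bsub>FIET_group\<^esub> inv\<^bsub>FIET_group\<^esub> g \<in> FIET_finsupp \<longleftrightarrow>
     finite {x \<in> unit_Ico. f x \<noteq> g x}"
proof -
  interpret group FIET_group by (rule group_FIET_group)
  have bg: "bij_betw g unit_Ico unit_Ico" using g by (auto simp: FIET_group_simps Bij_def)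
  let ?h = "f \<otimes>\<^bsub>FIET_group\<^esub> inv\<^bsub>FIET_group\<^esub> g"
  have h: "?h \<in> carrier FIET_group" using f g by simp
  have "?h \<otimes>\<^bsub>FIET_group\<^esub> g = f" using f g by (simp add: m_assoc)
  then have hg: "?h (g x) = f x" if "x \<in> unit_Ico" for x
    using FIET_group_simps(3)[OF h g] that by (metis compose_eq)
  have eq: "{x \<in> unit_Ico. ?h x \<noteq> x} = g ` {x \<in> unit_Ico. f x \<noteq> g x}"
  proof (intro equalityI subsetI)
    fix y assume y: "y \<in> {x \<in> unit_Ico. ?h x \<noteq> x}"
    then obtain x where "x \<in> unit_Ico" "y = g x" using bij_betw_imp_surj_on[OF bg] by blast
    then show "y \<in> g ` {x \<in> unit_Ico. f x \<noteq> g x}" using y hg by auto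
  next
    fix y assume "y \<in> g ` {x \<in> unit_Ico. f x \<noteq> g x}"
    then obtain x where x: "x \<in> unit_Ico" "f x \<noteq> g x" "y = g x" by auto
    moreover have "g x \<in> unit_Ico" using bg x(1) bij_betwE by blast
    ultimately show "y \<in> {x \<in> unit_Ico. ?h x \<noteq> x}" using hg by auto
  qed
  have "inj_on g {x \<in> unit_Ico. f x \<noteq> g x}"
    using bij_betw_imp_inj_on[OF bg] by (rule inj_on_subset) auto
  then have "finite {x \<in> unit_Ico. ?h x \<noteq> x} \<longleftrightarrow> finite {x \<in> unit_Ico. f x \<noteq> g x}"
    unfolding eq by (rule finite_image_iff)
  then show ?thesis using h unfolding FIET_finsupp_def by blast
qed

lemma normal_FIET_finsupp: "FIET_finsupp \<lhd> FIET_group"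
proof -
  interpret group FIET_group by (rule group_FIET_group)
  have ap: "(a \<otimes>\<^bsub>FIET_group\<^esub> b) x = a (b x)"
    if "a \<in> carrier FIET_group" "b \<in> carrier FIET_group" "x \<in> unit_Ico" for a b x
    using that by (simp add: FIET_group_simps(3) compose_eq)
  have mem: "b x \<in> unit_Ico" if "b \<in> carrier FIET_group" "x \<in> unit_Ico" for b x
    using that bij_betwE unfolding FIET_group_simps Bij_def by blast
  have sub: "subgroup FIET_finsupp FIET_group"
  proof (rule subgroupI)
    show "FIET_finsupp \<subseteq> carrier FIET_group" by (auto simp: FIET_finsupp_def)
    have "{x \<in> unit_Ico. (\<lambda>x\<in>unit_Ico. x) x \<noteq> x} = {}" by auto
    then have "\<one>\<^bsub>FIET_group\<^esub> \<in> FIET_finsupp"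
      unfolding FIET_finsupp_def using one_closed by (simp only: FIET_group_simps(2) mem_Collect_eq) simp
    then show "FIET_finsupp \<noteq> {}" by auto
    fix a assume a: "a \<in> FIET_finsupp"
    then have ac: "a \<in> carrier FIET_group" and fa: "finite {x \<in> unit_Ico. a x \<noteq> x}"
      by (auto simp: FIET_finsupp_def)
    have "finite {x \<in> unit_Ico. \<one>\<^bsub>FIET_group\<^esub> x \<noteq> a x}"
      using fa by (rule rev_finite_subset) (auto simp: FIET_group_simps(2))
    then show "inv\<^bsub>FIET_group\<^esub> a \<in> FIET_finsupp"
      using FIET_mult_inv_in_finsupp_iff[OF one_closed ac] ac by simp
    fix b assume b: "b \<in> FIET_finsupp"
    then have bc: "b \<in> carrier FIET_group" and fb: "finite {x \<in> unit_Ico. b x \<noteq> x}"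
      by (auto simp: FIET_finsupp_def)
    have "finite {x \<in> unit_Ico. (a \<otimes>\<^bsub>FIET_group\<^esub> b) x \<noteq> x}"
      by (rule finite_subset[OF _ finite_UnI[OF fa fb]]) (auto simp: ap ac bc)
    then show "a \<otimes>\<^bsub>FIET_group\<^esub> b \<in> FIET_finsupp"
      using ac bc by (simp add: FIET_finsupp_def)
  qed
  show ?thesis
  proof (rule normal_invI[OF sub])
    fix x h assume xc: "x \<in> carrier FIET_group" and h: "h \<in> FIET_finsupp"
    then have hc: "h \<in> carrier FIET_group" and fh: "finite {y \<in> unit_Ico. h y \<noteq> y}"
      by (auto simp: FIET_finsupp_def)
    have "finite {y \<in> unit_Ico. (x \<otimes>\<^bsub>FIET_group\<^esub> h) y \<noteq> x y}"
      using fh by (rule rev_finite_subset) (auto simp: ap xc hc)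
    then show "x \<otimes>\<^bsub>FIET_group\<^esub> h \<otimes>\<^bsub>FIET_group\<^esub> inv\<^bsub>FIET_group\<^esub> x \<in> FIET_finsupp"
      using FIET_mult_inv_in_finsupp_iff[of "x \<otimes>\<^bsub>FIET_group\<^esub> h" x] xc hc by simp
  qed
qed

lemma group_FIET_bar: "group FIET_bar"
  unfolding FIET_bar_def by (rule normal.factorgroup_is_group[OF normal_FIET_finsupp])

lemma FIET_coset_eq_iff:
  assumes "f \<in> carrier FIET_group" "g \<in> carrier FIET_group"
  shows "FIET_finsupp #>\<^bsub>FIET_group\<^esub> f = FIET_finsupp #>\<^bsub>FIET_group\<^esub> g \<longleftrightarrow>
     finite {x \<in> unit_Ico. f x \<noteq> g x}"
proof -
  interpret normal FIET_finsupp FIET_group by (rule normal_FIET_finsupp)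
  have "FIET_finsupp #>\<^bsub>FIET_group\<^esub> f = FIET_finsupp #>\<^bsub>FIET_group\<^esub> g \<longleftrightarrow>
      f \<in> FIET_finsupp #>\<^bsub>FIET_group\<^esub> g"
    using repr_independence[OF _ assms(2) subgroup_axioms, of f] rcos_self[OF assms(1) subgroup_axioms]
    by blast
  also have "\<dots> \<longleftrightarrow> f \<otimes>\<^bsub>FIET_group\<^esub> inv\<^bsub>FIET_group\<^esub> g \<in> FIET_finsupp"
    by (rule rcos_module[OF is_group assms(2,1)])
  finally have "FIET_finsupp #>\<^bsub>FIET_group\<^esub> f = FIET_finsupp #>\<^bsub>FIET_group\<^esub> g \<longleftrightarrow>
      f \<otimes>\<^bsub>FIET_group\<^esub> inv\<^bsub>FIET_group\<^esub> g \<in> FIET_finsupp" .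
  then show ?thesis using FIET_mult_inv_in_finsupp_iff[OF assms] by simp
qed

end

theory Submission
  imports Defs "HOL-Combinatorics.Cycles"
begin

text \<open>
  Every class is shown to be a product of five commutators.

  First, some elements are single commutators: a simultaneous flip of disjoint intervals
  (\<open>mflip_Comms\<close>, by cutting each interval into quarters), and a permutation of the cells of a regular
  grid (\<open>cellmap_Comms\<close>, because a permutation is conjugate to its inverse by an involution).

  Secondly, an exchange with at most \<open>K\<close> breaks supported in \<open>[0, u)\<close> is a product of at most \<open>2 K + 2\<close> flips
  of subintervals, whatever the size of \<open>u\<close> (\<open>sort_by_flips\<close>). A product of \<open>N\<close> flips in \<open>[0, u)\<close> with
  \<open>(N + 1) u \<le> 1\<close> is a product of two commutators, by displacing \<open>[0, u)\<close> to \<open>N + 1\<close> disjoint copies of itself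
  (\<open>flips_two_commut\<close>).

  Finally, let \<open>g\<close> be an exchange of \<open>m\<close> intervals. Composing it with a simultaneous flip, one may assume that \<open>g\<close>
  reverses the orientation of all of them. On a grid of mesh \<open>1/n\<close>, such a \<open>g\<close> agrees with \<open>P R\<close> outside
  \<open>O(m)\<close> cells, where \<open>P\<close> permutes cells and \<open>R\<close> flips one interval inside each of the \<open>m\<close> pieces. The remaining
  factor \<open>R\<inverse> P\<inverse> g\<close> has \<open>O(m)\<close> breaks and is supported in \<open>O(m)\<close> cells. Both bounds are independent of \<open>n\<close>, and
  so for large \<open>n\<close> this factor is a product of two commutators (\<open>small_support_Comms\<close>,
  \<open>reversing_exchange_Comms\<close>).
\<close>

text \<open>In what follows \<open>inv f\<close> denotes the inverse function; inverses in a group \<open>G\<close> are written \<open>m_inv G\<close>.\<close>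

unbundle no m_inv_syntax

section \<open>Local isometries of the line\<close>

text \<open>Near \<open>x\<close> the map \<open>f\<close> is affine of slope \<open>1\<close> or \<open>-1\<close>; the neighbourhood is two-sided, so that
\<open>f\<close> is in particular continuous at \<open>x\<close>.\<close>

definition isometric_at :: "(real \<Rightarrow> real) \<Rightarrow> real \<Rightarrow> bool" where
  "isometric_at f x \<longleftrightarrow> (\<exists>s\<in>{1, -1}. \<forall>\<^sub>F y in nhds x. f y = f x + s * (y - x))"

text \<open>The exact set of points where \<open>f\<close> fails to be a local isometry. Its cardinality is the measure of
complexity used throughout: for bijections, it is subadditive under composition and
invariant under inversion.\<close>

definition breaks :: "(real \<Rightarrow> real) \<Rightarrow> real set" where
  "breaks f = {x. \<not> isometric_at f x}"

lemma isometric_atI: "s = 1 \<or> s = -1 \<Longrightarrow> \<forall>\<^sub>F y in nhds x. f y = f x + s * (y - x) \<Longrightarrow> isometric_at f x"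
  by (auto simp: isometric_at_def)

lemma isometric_atE:
  assumes "isometric_at f x"
  obtains s where "s = 1 \<or> s = -1" "\<forall>\<^sub>F y in nhds x. f y = f x + s * (y - x)"
  using assms unfolding isometric_at_def by blast

lemma isometric_at_affineI:
  assumes "open X" "x \<in> X" "s = 1 \<or> s = -1" "\<And>y. y \<in> X \<Longrightarrow> f y = s * y + c"
  shows "isometric_at f x"
proof (rule isometric_atI[OF assms(3)])
  show "\<forall>\<^sub>F y in nhds x. f y = f x + s * (y - x)"
    unfolding eventually_nhds using assms by (intro exI[of _ X]) (auto simp: algebra_simps)
qed

lemma isometric_at_tendsto:
  assumes "isometric_at f x" shows "(f \<longlongrightarrow> f x) (nhds x)"
proof -
  obtain s where s: "\<forall>\<^sub>F y in nhds x. f y = f x + s * (y - x)"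
    using assms unfolding isometric_at_def by blast
  have "((\<lambda>y. f x + s * (y - x)) \<longlongrightarrow> f x + s * (x - x)) (nhds x)"
    by (intro tendsto_intros filterlim_ident)
  then show ?thesis
    using tendsto_cong[OF s] by simp
qed

lemma isometric_at_id [simp]: "isometric_at id x" "isometric_at (\<lambda>x. x) x"
  by (auto intro!: isometric_atI[of 1])

lemma isometric_at_comp:
  assumes g: "isometric_at g x" and f: "isometric_at f (g x)" shows "isometric_at (f \<circ> g) x"
proof -
  obtain s where s: "s = 1 \<or> s = -1" "\<forall>\<^sub>F y in nhds x. g y = g x + s * (y - x)"
    using g by (rule isometric_atE)
  obtain r where r: "r = 1 \<or> r = -1" "\<forall>\<^sub>F z in nhds (g x). f z = f (g x) + r * (z - g x)"
    using f by (rule isometric_atE)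
  have "\<forall>\<^sub>F y in nhds x. f (g y) = f (g x) + r * (g y - g x)"
    using filterlim_compose[OF _ isometric_at_tendsto[OF g]] r(2) isometric_at_tendsto[OF g]
    by (auto simp: filterlim_iff)
  with s(2) have "\<forall>\<^sub>F y in nhds x. (f \<circ> g) y = (f \<circ> g) x + (r * s) * (y - x)"
    by eventually_elim simp
  then show ?thesis using s(1) r(1) by (intro isometric_atI[of "r * s"]) auto
qed

lemma breaks_comp: "breaks (f \<circ> g) \<subseteq> breaks g \<union> g -` breaks f"
  using isometric_at_comp by (auto simp: breaks_def)

lemma isometric_at_inv:
  assumes "bij f" "isometric_at f x" shows "isometric_at (inv f) (f x)"
proof -
  obtain s where s: "s = 1 \<or> s = -1" "\<forall>\<^sub>F y in nhds x. f y = f x + s * (y - x)"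
    using assms(2) by (rule isometric_atE)
  have "((\<lambda>z. x + s * (z - f x)) \<longlongrightarrow> x + s * (f x - f x)) (nhds (f x))"
    by (intro tendsto_intros filterlim_ident)
  then have "\<forall>\<^sub>F z in nhds (f x). f (x + s * (z - f x)) = f x + s * (x + s * (z - f x) - x)"
    using s(2) by (auto simp: filterlim_iff)
  then have "\<forall>\<^sub>F z in nhds (f x). inv f z = inv f (f x) + s * (z - f x)"
  proof eventually_elim
    case (elim z)
    then have "f (x + s * (z - f x)) = z" using s(1) by auto
    then show ?case using assms(1) by (metis bij_inv_eq_iff)
  qed
  then show ?thesis using s(1) by (intro isometric_atI[of s])
qed

lemma breaks_inv:
  assumes "bij f" shows "breaks (inv f) = f ` breaks f"
proof -
  have "isometric_at (inv f) (f x) \<longleftrightarrow> isometric_at f x" for x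
    using isometric_at_inv[OF assms, of x] isometric_at_inv[OF bij_imp_bij_inv[OF assms], of "f x"] assms
    by (auto simp: inv_inv_eq bij_is_inj)
  then show ?thesis
    unfolding breaks_def using assms
    by (auto simp: image_iff) (metis bij_inv_eq_iff)
qed

text \<open>A local isometry of slope \<open>\<plusminus>1\<close> has locally constant slope, hence constant slope on a connected set.\<close>

lemma isometric_at_connected:
  assumes X: "connected X" and iso: "X \<inter> breaks f = {}" 
  obtains s c where "s = 1 \<or> s = -1" "\<And>x. x \<in> X \<Longrightarrow> f x = s * x + c"
proof (cases "X = {}")
  case False
  then obtain x0 where x0: "x0 \<in> X" by auto
  have li: "isometric_at f x" if "x \<in> X" for x using iso that by (auto simp: breaks_def)
  have D: "\<exists>s. (s = 1 \<or> s = -1) \<and> (\<exists>U. open U \<and> x \<in> U \<and> (\<forall>y\<in>U. f y = f x + s * (y - x) \<and> deriv f y = s))"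
    if "x \<in> X" for x
  proof -
    obtain s where s: "s = 1 \<or> s = -1" "\<forall>\<^sub>F y in nhds x. f y = f x + s * (y - x)"
      using li[OF \<open>x \<in> X\<close>] by (rule isometric_atE)
    obtain U where U: "open U" "x \<in> U" "\<forall>y\<in>U. f y = f x + s * (y - x)"
      using s(2) unfolding eventually_nhds by blast
    have "deriv f y = s" if "y \<in> U" for y
    proof -
      have "((\<lambda>y. f x + s * (y - x)) has_field_derivative s) (at y)"
        by (auto intro!: derivative_eq_intros)
      then have "(f has_field_derivative s) (at y)"
        by (rule has_field_derivative_transform_within_open[OF _ U(1) that]) (use U(3) in metis)
      then show ?thesis by (rule DERIV_imp_deriv)
    qed
    then show ?thesis using s(1) U by blast
  qed
  define s where "s = deriv f x0"
  have ds: "deriv f x = s" if "x \<in> X" for x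
  proof -
    have "deriv f constant_on X"
    proof (rule locally_constant_imp_constant[OF X])
      fix a assume "a \<in> X"
      from D[OF this] obtain s U where "open U" "a \<in> U" "\<forall>y\<in>U. deriv f y = s" by metis
      then show "\<exists>T. openin (top_of_set X) T \<and> a \<in> T \<and> (\<forall>x\<in>T. deriv f x = deriv f a)"
        using \<open>a \<in> X\<close> by (intro exI[of _ "X \<inter> U"]) auto
    qed
    then show ?thesis using that x0 by (auto simp: constant_on_def s_def)
  qed
  have "(\<lambda>x. f x - s * x) constant_on X"
  proof (rule locally_constant_imp_constant[OF X])
    fix a assume a: "a \<in> X"
    from D[OF this] obtain s' U where U: "open U" "a \<in> U" "\<And>y. y \<in> U \<Longrightarrow> f y = f a + s' * (y - a)" "\<forall>y\<in>U. deriv f y = s'" by metis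
    then have s': "s' = s" using ds a by auto
    have *: "\<forall>x\<in>X \<inter> U. f x - s * x = f a - s * a"
    proof
      fix x assume "x \<in> X \<inter> U"
      then have "f x = f a + s' * (x - a)" using U(3) by blast
      then show "f x - s * x = f a - s * a" using s' by (simp add: algebra_simps)
    qed
    have "openin (top_of_set X) (X \<inter> U)" "a \<in> X \<inter> U" using U(1,2) a by auto
    with * show "\<exists>T. openin (top_of_set X) T \<and> a \<in> T \<and> (\<forall>x\<in>T. f x - s * x = f a - s * a)"
      by blast
  qed
  then obtain c where "\<And>x. x \<in> X \<Longrightarrow> f x - s * x = c" by (auto simp: constant_on_def)
  moreover have "s = 1 \<or> s = -1" using D[OF x0] ds[OF x0] by auto
  ultimately show ?thesis using that[of s c] by (auto simp: algebra_simps)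
qed (use that in blast)

section \<open>Piecewise isometries and commutators modulo finite sets\<close>

text \<open>Interval exchanges with flips, extended by the identity to bijections of the whole line. Working on
the line makes composition and inversion those of plain functions.\<close>

definition PIso :: "(real \<Rightarrow> real) set" where
  "PIso = {f. bij f \<and> (\<forall>x. x \<notin> {0..<1} \<longrightarrow> f x = x) \<and> finite (breaks f)}"

lemma PIsoD:
  assumes "f \<in> PIso"
  shows "bij f" "inj f" "surj f" "x \<notin> {0..<1} \<Longrightarrow> f x = x" "finite (breaks f)"
  using assms by (auto simp: PIso_def bij_is_inj bij_is_surj)

lemma bij_preserves_support:
  assumes "bij f" "\<And>x. x \<notin> X \<Longrightarrow> f x = x" shows "f x \<in> X \<longleftrightarrow> x \<in> X"
  using assms by (metis bij_pointE)

lemma PIso_mem_iff: "f \<in> PIso \<Longrightarrow> f x \<in> {0..<1} \<longleftrightarrow> x \<in> {0..<1}"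
  using bij_preserves_support[of f "{0..<1}" x] PIsoD by blast

lemma PIso_comp [intro]:
  assumes "f \<in> PIso" "g \<in> PIso" shows "f \<circ> g \<in> PIso"
proof -
  have "finite (breaks (f \<circ> g))"
    using PIsoD[OF assms(1)] PIsoD[OF assms(2)]
    by (intro finite_subset[OF breaks_comp] finite_UnI finite_vimageI) auto
  then show ?thesis using assms by (auto simp: PIso_def intro: bij_comp)
qed

lemma PIso_inv [intro]:
  assumes "f \<in> PIso" shows "inv f \<in> PIso"
proof -
  have "inv f x = x" if "x \<notin> {0..<1}" for x
    using PIsoD(1,4)[OF assms] that by (metis bij_inv_eq_iff)
  then show ?thesis using assms by (auto simp: PIso_def breaks_inv bij_imp_bij_inv)
qed

lemma PIso_id [simp, intro]: "id \<in> PIso"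
  by (auto simp: PIso_def breaks_def)

text \<open>Equality outside a finite set.\<close>

definition fin_eq :: "(real \<Rightarrow> real) \<Rightarrow> (real \<Rightarrow> real) \<Rightarrow> bool"  (infix "\<approx>\<^sub>f" 50) where
  "f \<approx>\<^sub>f g \<longleftrightarrow> finite {x. f x \<noteq> g x}"

lemma fin_eq_refl [simp]: "f \<approx>\<^sub>f f" by (simp add: fin_eq_def)

lemma fin_eq_trans [trans]: "f \<approx>\<^sub>f g \<Longrightarrow> g \<approx>\<^sub>f h \<Longrightarrow> f \<approx>\<^sub>f h"
  unfolding fin_eq_def
  by (rule finite_subset[of _ "{x. f x \<noteq> g x} \<union> {x. g x \<noteq> h x}"]) auto

lemma fin_eqI: "finite S \<Longrightarrow> (\<And>x. x \<notin> S \<Longrightarrow> f x = g x) \<Longrightarrow> f \<approx>\<^sub>f g"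
  unfolding fin_eq_def by (erule rev_finite_subset) auto

lemma fin_eq_comp:
  assumes "f \<approx>\<^sub>f f'" "g \<approx>\<^sub>f g'" "inj g'" shows "f \<circ> g \<approx>\<^sub>f f' \<circ> g'"
  unfolding fin_eq_def
proof (rule finite_subset)
  show "{x. (f \<circ> g) x \<noteq> (f' \<circ> g') x} \<subseteq> {x. g x \<noteq> g' x} \<union> g' -` {x. f x \<noteq> f' x}" by auto
  show "finite ({x. g x \<noteq> g' x} \<union> g' -` {x. f x \<noteq> f' x})"
    using assms unfolding fin_eq_def by (intro finite_UnI finite_vimageI)
qed

text \<open>The commutator \<open>f g f\<inverse> g\<inverse>\<close> of two bijections of the line.\<close>

definition commut :: "(real \<Rightarrow> real) \<Rightarrow> (real \<Rightarrow> real) \<Rightarrow> real \<Rightarrow> real" where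
  "commut f g = f \<circ> g \<circ> inv f \<circ> inv g"

lemma commut_PIso [intro]: "f \<in> PIso \<Longrightarrow> g \<in> PIso \<Longrightarrow> commut f g \<in> PIso"
  unfolding commut_def by blast

text \<open>The piecewise isometries whose classes modulo finite sets are commutators.\<close>

definition Comms :: "(real \<Rightarrow> real) set" where
  "Comms = {f \<in> PIso. \<exists>a\<in>PIso. \<exists>b\<in>PIso. f \<approx>\<^sub>f commut a b}"

lemma CommsI: "f \<in> PIso \<Longrightarrow> a \<in> PIso \<Longrightarrow> b \<in> PIso \<Longrightarrow> f \<approx>\<^sub>f commut a b \<Longrightarrow> f \<in> Comms"
  by (auto simp: Comms_def)

lemma commut_Comms: "a \<in> PIso \<Longrightarrow> b \<in> PIso \<Longrightarrow> commut a b \<in> Comms"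
  by (auto simp: Comms_def intro: fin_eq_refl)

lemma Comms_PIso: "f \<in> Comms \<Longrightarrow> f \<in> PIso" by (simp add: Comms_def)

lemma Comms_conj:
  assumes f: "f \<in> Comms" and c: "c \<in> PIso" shows "c \<circ> f \<circ> inv c \<in> Comms"
proof -
  obtain a b where ab: "a \<in> PIso" "b \<in> PIso" "f \<approx>\<^sub>f commut a b" using f by (auto simp: Comms_def)
  have bij: "bij a" "bij b" "bij c" using PIsoD ab c by auto
  have inv: "inv (c \<circ> a \<circ> inv c) = c \<circ> inv a \<circ> inv c" "inv (c \<circ> b \<circ> inv c) = c \<circ> inv b \<circ> inv c"
    using bij by (simp_all add: o_inv_distrib bij_comp bij_imp_bij_inv inv_inv_eq comp_assoc)
  have cc: "inv c \<circ> (c \<circ> g) = g" for g :: "real \<Rightarrow> real"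
    using bij(3) by (simp add: bij_is_inj flip: comp_assoc)
  have "commut (c \<circ> a \<circ> inv c) (c \<circ> b \<circ> inv c) = c \<circ> commut a b \<circ> inv c"
    unfolding commut_def inv by (simp add: comp_assoc cc)
  moreover have "c \<circ> f \<circ> inv c \<approx>\<^sub>f c \<circ> commut a b \<circ> inv c"
    using ab c PIsoD(2)[OF commut_PIso[OF ab(1,2)]] PIsoD(2)[OF PIso_inv[OF c]] 
    by (intro fin_eq_comp) simp_all
  ultimately show ?thesis using ab c Comms_PIso[OF f]
    by (intro CommsI[of _ "c \<circ> a \<circ> inv c" "c \<circ> b \<circ> inv c"] PIso_comp PIso_inv) simp_all
qed

section \<open>Flips\<close>

text \<open>The reversal of the open interval \<open>(a, b)\<close>. Both endpoints are fixed, which makes it an involution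
of the line; for \<open>b \<le> a\<close> it is the identity.\<close>

definition flip :: "real \<Rightarrow> real \<Rightarrow> real \<Rightarrow> real" where
  "flip a b x = (if a < x \<and> x < b then a + b - x else x)"

lemma flip_flip [simp]: "flip a b (flip a b x) = x" "flip a b \<circ> flip a b = id"
  by (auto simp: flip_def fun_eq_iff)

lemma bij_flip [simp]: "bij (flip a b)" by (rule o_bij[of "flip a b"]) simp_all

lemma inv_flip [simp]: "inv (flip a b) = flip a b" by (rule inv_unique_comp) simp_all

lemma flip_outside: "x \<notin> {a<..<b} \<Longrightarrow> flip a b x = x" by (auto simp: flip_def)

lemma isometric_at_flip: 
  assumes "x \<noteq> a" "x \<noteq> b" shows "isometric_at (flip a b) x"
proof -
  consider "x \<in> {a<..<b}" | "x \<in> {..<a}" | "x \<in> {b<..}" using assms by force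
  then show ?thesis
  proof cases
    case 1 then show ?thesis by (intro isometric_at_affineI[of "{a<..<b}" x "-1" _ "a + b"]) (auto simp: flip_def)
  next
    case 2 then show ?thesis by (intro isometric_at_affineI[of "{..<a}" x 1 _ 0]) (auto simp: flip_def)
  next
    case 3 then show ?thesis by (intro isometric_at_affineI[of "{b<..}" x 1 _ 0]) (auto simp: flip_def)
  qed
qed

lemma breaks_flip: "breaks (flip a b) \<subseteq> {a, b}"
  using isometric_at_flip by (auto simp: breaks_def)

lemma flip_PIso: "0 \<le> a \<Longrightarrow> b \<le> 1 \<Longrightarrow> flip a b \<in> PIso"
  using finite_subset[OF breaks_flip] by (auto simp: PIso_def flip_def)

section \<open>Sorting by flips\<close>

text \<open>The composition of the flips of a list of intervals, the head of the list being applied last.\<close>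

primrec flips :: "(real \<times> real) list \<Rightarrow> real \<Rightarrow> real" where
  "flips [] = id"
| "flips (p # ps) = flip (fst p) (snd p) \<circ> flips ps"

lemma flips_append: "flips (ps @ qs) = flips ps \<circ> flips qs"
  by (induction ps) (auto simp: comp_assoc)

lemma flip_almost_flip_comp:
  assumes f: "f \<circ> flip a b \<approx>\<^sub>f g" shows "f \<approx>\<^sub>f g \<circ> flip a b"
proof -
  have "f \<circ> flip a b \<circ> flip a b \<approx>\<^sub>f g \<circ> flip a b"
    by (intro fin_eq_comp f bij_is_inj) auto
  then show ?thesis by (simp add: comp_assoc)
qed

lemma infinite_ivl: "a < b \<Longrightarrow> finite A \<Longrightarrow> \<exists>x\<in>{a<..<b::real}. x \<notin> A"
  by (meson infinite_Ioo finite_subset subsetI)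

text \<open>Sorting by reversals. Let \<open>(l, t)\<close> be the leftmost piece of \<open>f\<inverse>\<close>, that is, the image of some piece
\<open>(u, v)\<close> of \<open>f\<close>. Precomposing \<open>f\<close> with the flip of \<open>(l, v)\<close>, which moves \<open>(u, v)\<close> to \<open>(l, t)\<close>, and if
necessary with the flip of \<open>(l, t)\<close>, gives a map that is the identity on \<open>(l, t)\<close> and, unless \<open>t = L\<close>, has
fewer breaks in \<open>(t, L)\<close> than \<open>f\<close> has in \<open>(l, L)\<close>. Hence the number of flips is bounded in terms of the number of breaks only,
independently of the lengths of the pieces.\<close>

lemma sort_by_flips:
  assumes "bij f" "finite (breaks f)" "l < L" "finite {x. x \<notin> {l..L} \<and> f x \<noteq> x}"
  shows "\<exists>ps. length ps \<le> 2 * card (breaks f \<inter> {l<..<L}) + 2 \<and>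
              (\<forall>p\<in>set ps. l \<le> fst p \<and> snd p \<le> L) \<and> f \<approx>\<^sub>f flips ps"
  using assms
proof (induction "card (breaks f \<inter> {l<..<L})" arbitrary: f l rule: less_induct)
  case less
  note bij = less.prems(1) and fin = less.prems(2) and lL = less.prems(3) and out = less.prems(4)
  have inj: "inj f" and surj: "surj f" using bij by (auto simp: bij_is_inj bij_is_surj)
  let ?B = "breaks f \<inter> {l<..<L}"
  define T where "T = f ` breaks f \<inter> {l<..<L}"
  define t where "t = (if T = {} then L else Min T)"
  have finT: "finite T" using fin by (simp add: T_def)
  have tT: "t \<in> T" if "t < L" using that finT by (auto simp: t_def split: if_splits)
  have lt: "l < t" "t \<le> L" using finT lL Min_in[OF finT]
    by (auto simp: t_def T_def intro: less_imp_le)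
  have T_ge: "t \<le> y" if "y \<in> T" for y using that finT by (auto simp: t_def)
  have noB: "{l<..<t} \<inter> breaks (inv f) = {}"
    using T_ge lt by (force simp: breaks_inv[OF bij] T_def)
  obtain s c where s: "s = 1 \<or> s = -1" and sc: "\<And>y. y \<in> {l<..<t} \<Longrightarrow> inv f y = s * y + c"
    by (rule isometric_at_connected[OF connected_Ioo noB]) blast
  define u v where "u = (if s = 1 then l + c else c - t)" and "v = (if s = 1 then t + c else c - l)"
  have vu: "v - u = t - l" using s by (auto simp: u_def v_def)
  have fuv: "f x = s * (x - c)" "s * (x - c) \<in> {l<..<t}" if "x \<in> {u<..<v}" for x
  proof -
    show *: "s * (x - c) \<in> {l<..<t}" using that s by (auto simp: u_def v_def)
    have "inv f (s * (x - c)) = x" using sc[OF *] s by auto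
    then show "f x = s * (x - c)" using bij by (metis bij_inv_eq_iff)
  qed
  \<comment> \<open>The piece \<open>(u, v)\<close> lies in \<open>[l, L]\<close>, since \<open>f\<close> almost fixes the complement.\<close>
  have bad: "f x \<noteq> x" if "x \<notin> {l..L}" "f x \<in> {l..L}" for x using that by metis
  have lu: "l \<le> u"
  proof (rule ccontr)
    assume "\<not> l \<le> u"
    then obtain x where "x \<in> {u<..<min l v}" "x \<notin> {x. x \<notin> {l..L} \<and> f x \<noteq> x}"
      using infinite_ivl[OF _ out, of u "min l v"] vu lt by auto
    then show False using fuv[of x] lt bad[of x] by auto
  qed
  have vL: "v \<le> L"
  proof (rule ccontr)
    assume "\<not> v \<le> L"
    then obtain x where "x \<in> {max L u<..<v}" "x \<notin> {x. x \<notin> {l..L} \<and> f x \<noteq> x}"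
      using infinite_ivl[OF _ out, of "max L u" v] vu lt by auto
    then show False using fuv[of x] lt bad[of x] by auto
  qed
  have tv: "t \<le> v" using vu lu by simp
  have tB: "e \<in> breaks f" if "f e = t" "t < L" for e
    using tT[OF that(2)] that(1) inj by (auto simp: T_def dest: injD)
  \<comment> \<open>If \<open>f\<close> were isometric across the end \<open>e\<close> of \<open>(u, v)\<close>, then either \<open>t = f e\<close> would not be a break
of \<open>f\<inverse>\<close>, or \<open>f\<close> would map points of \<open>(l, L)\<close> next to \<open>e\<close> onto an interval just below \<open>l\<close>, almost all
of whose points are fixed.\<close>
  have inner_break: "e \<in> breaks f" if e: "e = u \<or> e = v" "l < e" "e < L" "t < L" for e
  proof (rule ccontr)
    assume "e \<notin> breaks f"
    then have "isometric_at f e" by (simp add: breaks_def)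
    then obtain r where r: "r = 1 \<or> r = -1" "\<forall>\<^sub>F y in nhds e. f y = f e + r * (y - e)"
      by (rule isometric_atE)
    then obtain d where d: "d > 0" "\<And>y. \<bar>y - e\<bar> < d \<Longrightarrow> f y = f e + r * (y - e)"
      by (auto simp: eventually_nhds_metric dist_real_def)
    define d' where "d' = Min {d, v - u, e - l, L - e}"
    have d': "d' > 0" "d' \<le> d" "d' \<le> v - u" "d' \<le> e - l" "d' \<le> L - e"
      using d vu lt e by (auto simp: d'_def)
    define sg where "sg = (if e = u then 1 else -1 :: real)"
    have sg: "sg = 1 \<or> sg = -1" by (auto simp: sg_def)
    have in1: "f e + r * (sg * h) = s * (e + sg * h - c)" if "0 < h" "h < d'" for h
    proof -
      have "e + sg * h \<in> {u<..<v}" using that d' e(1) by (auto simp: sg_def)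
      then show ?thesis using fuv(1)[of "e + sg * h"] d(2)[of "e + sg * h"] that d' sg by auto
    qed
    have eq1: "f e + r * (sg * (d'/2)) = s * (e + sg * (d'/2) - c)"
     and eq2: "f e + r * (sg * (d'/3)) = s * (e + sg * (d'/3) - c)"
      using in1[of "d'/2"] in1[of "d'/3"] d'(1) by auto
    have rs: "r = s" using eq1 eq2 r(1) s sg d'(1) by auto
    then have fe: "f e = s * (e - c)" using eq1 by (simp add: algebra_simps)
    then have "f e = t \<or> f e = l" using e(1) s by (auto simp: u_def v_def)
    then show False
    proof
      assume "f e = t" then show False using tB[OF _ e(4)] \<open>e \<notin> breaks f\<close> by auto
    next
      assume fel: "f e = l"
      have neg: "s * sg = 1" using fel fe s e(1) lt(1) by (auto simp: sg_def u_def v_def)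
      have below: "f (e - sg * h) = l - h" "e - sg * h \<in> {l..L}" if "0 < h" "h < d'" for h
      proof -
        show "f (e - sg * h) = l - h"
          using d(2)[of "e - sg * h"] that d' sg rs neg fel by auto
        show "e - sg * h \<in> {l..L}" using that d' sg by auto
      qed
      have "\<exists>y\<in>{l-d'<..<l}. y \<notin> {x. x \<notin> {l..L} \<and> f x \<noteq> x}"
        using infinite_ivl[OF _ out, of "l - d'" l] d' by auto
      then obtain y where y: "y \<in> {l-d'<..<l}" "f y = y" by auto
      then have "f (e - sg * (l - y)) = f y" using below(1)[of "l - y"] by auto
      then have "e - sg * (l - y) = y" using inj by (auto dest: injD)
      then show False using below(2)[of "l - y"] y by auto
    qed
  qed
  define w where "w = (if s = 1 then t else l)"
  define r where "r = flip l v"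
  define r' where "r' = flip l w"
  define f' where "f' = f \<circ> r \<circ> r'"
  have f'id: "f' x = x" if x: "x \<in> {l<..<t}" for x
  proof -
    have rr: "r' x \<in> {l<..<t}" using x by (auto simp: r'_def w_def flip_def)
    then have "r (r' x) = l + v - r' x" using tv by (auto simp: r_def flip_def)
    moreover from this have "r (r' x) \<in> {u<..<v}" using rr vu by auto
    ultimately have "f' x = s * (l + v - r' x - c)" using fuv(1) by (simp add: f'_def)
    then show ?thesis using s x by (auto simp: r'_def w_def flip_def v_def)
  qed
  have f'out: "f' x = f x" if "x \<notin> {l..L}" for x
    using that vL lt by (auto simp: f'_def r_def r'_def flip_def w_def)
  have fin': "finite {x. x \<notin> {t..L} \<and> f' x \<noteq> x}"
  proof (rule finite_subset)
    show "{x. x \<notin> {t..L} \<and> f' x \<noteq> x} \<subseteq> insert l {x. x \<notin> {l..L} \<and> f x \<noteq> x}"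
    proof
      fix x assume "x \<in> {x. x \<notin> {t..L} \<and> f' x \<noteq> x}"
      then have x: "x \<notin> {t..L}" "f' x \<noteq> x" by auto
      then have "x \<notin> {l<..<t}" using f'id by blast
      then have "x = l \<or> x \<notin> {l..L}" using x(1) by auto
      then show "x \<in> insert l {x. x \<notin> {l..L} \<and> f x \<noteq> x}" using x(2) f'out by auto
    qed
  qed (use out in simp)
  have w: "l \<le> w" "w \<le> L" using lt by (auto simp: w_def)
  have unsort: "\<exists>ps. length ps \<le> k + 2 \<and> (\<forall>p\<in>set ps. l \<le> fst p \<and> snd p \<le> L) \<and> f \<approx>\<^sub>f flips ps"
    if "length qs \<le> k" "\<forall>p\<in>set qs. l \<le> fst p \<and> snd p \<le> L" "f' \<approx>\<^sub>f flips qs" for qs k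
  proof (intro exI[of _ "qs @ [(l, w), (l, v)]"] conjI)
    have "f \<circ> r \<circ> r' \<approx>\<^sub>f flips qs" using that(3) by (simp add: f'_def)
    then have "f \<approx>\<^sub>f flips qs \<circ> r' \<circ> r"
      unfolding r_def r'_def by (intro flip_almost_flip_comp)
    then show "f \<approx>\<^sub>f flips (qs @ [(l, w), (l, v)])"
      by (simp add: flips_append r_def r'_def comp_assoc)
  qed (use that w vL in auto)
  show ?case
  proof (cases "t < L")
    case False
    have "f' \<approx>\<^sub>f id"
    proof (intro fin_eqI[of "insert l (insert L {x. x \<notin> {t..L} \<and> f' x \<noteq> x})"])
      fix x assume "x \<notin> insert l (insert L {x. x \<notin> {t..L} \<and> f' x \<noteq> x})"
      then have "f' x = x \<or> x \<in> {l<..<t}" using lt False by auto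
      then show "f' x = id x" using f'id by auto
    qed (use fin' in simp)
    then show ?thesis using unsort[of "[]" "2 * card ?B"] by auto
  next
    case True
    let ?B' = "breaks f' \<inter> {t<..<L}"
    have bij': "bij f'" unfolding f'_def r_def r'_def by (intro bij_comp bij bij_flip)
    have "finite (breaks (f \<circ> r \<circ> r'))"
    proof -
      have 1: "finite (breaks (f \<circ> r))"
        by (rule finite_subset[OF breaks_comp]) 
           (use fin in \<open>auto intro!: finite_vimageI bij_is_inj finite_subset[OF breaks_flip] simp: r_def\<close>)
      show ?thesis
        by (rule finite_subset[OF breaks_comp]) 
           (use 1 in \<open>auto intro!: finite_vimageI bij_is_inj finite_subset[OF breaks_flip] simp: r'_def\<close>)
    qed
    then have finb': "finite (breaks f')" by (simp add: f'_def)
    have vB: "v \<in> ?B" if "v < L" using inner_break[of v] that lt tv True by auto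
    \<comment> \<open>The right end \<open>t\<close> of the sorted part is the image of a break of \<open>f\<close>: this is the break that is lost.\<close>
    have tr: "t \<in> r ` ?B"
    proof (cases "l < u")
      case True
      then have "u \<in> ?B" using inner_break[of u] \<open>t < L\<close> vL vu lt by auto
      moreover have "r u = t" using True vu lt by (auto simp: r_def flip_def)
      ultimately show ?thesis by force
    next
      case False
      then have "v = t" using lu vu by simp
      then have "v \<in> ?B" "r v = t" using vB True by (auto simp: r_def flip_def)
      then show ?thesis by force
    qed
    have sub: "?B' \<subseteq> r ` ?B - {t}"
    proof
      fix x assume x: "x \<in> ?B'"
      then have xt: "x \<in> {t<..<L}" by simp
      have "x \<in> r ` ?B"
      proof (rule ccontr)
        assume nx: "x \<notin> r ` ?B"
        have rx: "r x \<in> {l<..<L}" using xt lt vL by (auto simp: r_def flip_def)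
        have "r x \<notin> breaks f" using nx rx by (metis IntI image_eqI flip_flip(1) r_def)
        moreover have "x \<noteq> v" using nx vB xt by (metis flip_outside greaterThanLessThan_iff image_eqI less_irrefl r_def)
        then have "isometric_at r x" using xt lt by (auto simp: r_def intro: isometric_at_flip)
        moreover have "isometric_at r' x" "r' x = x" 
          using xt lt by (auto simp: r'_def w_def flip_def intro!: isometric_at_flip)
        ultimately have "isometric_at f' x" unfolding f'_def
          by (intro isometric_at_comp) (auto simp: breaks_def)
        then show False using x by (simp add: breaks_def)
      qed
      then show "x \<in> r ` ?B - {t}" using xt by auto
    qed
    have finB: "finite ?B" using fin by simp
    have "card ?B' \<le> card (r ` ?B - {t})" using sub finB by (intro card_mono) auto
    also have "\<dots> < card (r ` ?B)" using tr finB by (intro psubset_card_mono) auto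
    also have "\<dots> \<le> card ?B" using finB by (rule card_image_le)
    finally have lessB: "card ?B' < card ?B" .
    obtain ps where ps: "length ps \<le> 2 * card ?B' + 2" "\<forall>p\<in>set ps. t \<le> fst p \<and> snd p \<le> L"
        "f' \<approx>\<^sub>f flips ps"
      using less.hyps[OF lessB bij' finb' True fin'] by blast
    then show ?thesis using unsort[of ps "2 * card ?B"] lessB lt by force
  qed
qed

section \<open>Permutations of cells\<close>

text \<open>The map that permutes the cells \<open>[u i, u (i + 1))\<close> by translations, the \<open>i\<close>-th cell going to the
\<open>p i\<close>-th. Negative numbers are fixed.\<close>

definition cellmap :: "real \<Rightarrow> (nat \<Rightarrow> nat) \<Rightarrow> real \<Rightarrow> real" where
  "cellmap u p x = (if x < 0 then x else x + u * (real (p (nat \<lfloor>x/u\<rfloor>)) - real (nat \<lfloor>x/u\<rfloor>)))"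

lemma cell_exists:
  assumes "u > 0" "x \<ge> 0"
  obtains i y where "x = u * real i + y" "0 \<le> y" "y < u"
proof
  show "x = u * real (nat \<lfloor>x/u\<rfloor>) + (x - u * real (nat \<lfloor>x/u\<rfloor>))" by simp
  have "real (nat \<lfloor>x/u\<rfloor>) = of_int \<lfloor>x/u\<rfloor>" using assms by simp
  moreover have "of_int \<lfloor>x/u\<rfloor> \<le> x/u" "x/u < of_int \<lfloor>x/u\<rfloor> + 1" by linarith+
  ultimately have "real (nat \<lfloor>x/u\<rfloor>) \<le> x/u" "x/u < real (nat \<lfloor>x/u\<rfloor>) + 1" by simp_all
  then show "0 \<le> x - u * real (nat \<lfloor>x/u\<rfloor>)" "x - u * real (nat \<lfloor>x/u\<rfloor>) < u"
    using assms(1) by (simp_all add: pos_le_divide_eq pos_divide_less_eq algebra_simps)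
qed

lemma cell_index:
  assumes "0 \<le> y" "y < u" shows "nat \<lfloor>(u * real i + y) / u\<rfloor> = i"
proof -
  have "(u * real i + y) / u = real i + y / u" using assms by (simp add: field_simps)
  moreover have "0 \<le> y / u" "y / u < 1" using assms by auto
  ultimately have "\<lfloor>(u * real i + y) / u\<rfloor> = int i" by linarith
  then show ?thesis by simp
qed

lemma cellmap_cell:
  assumes "0 \<le> y" "y < u" shows "cellmap u p (u * real i + y) = u * real (p i) + y"
proof -
  have "\<not> u * real i + y < 0" using assms by (auto simp: not_less)
  then show ?thesis unfolding cellmap_def cell_index[OF assms] by (simp add: algebra_simps)
qed

lemma cellmap_grid: "u > 0 \<Longrightarrow> cellmap u p (u * real i) = u * real (p i)"
  using cellmap_cell[of 0 u p i] by simp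

lemma cellmap_neg: "x < 0 \<Longrightarrow> cellmap u p x = x" by (simp add: cellmap_def)

lemma cell_induct [consumes 1, case_names neg cell]:
  assumes "u > 0" "\<And>x. x < 0 \<Longrightarrow> P x" "\<And>i y. 0 \<le> y \<Longrightarrow> y < u \<Longrightarrow> P (u * real i + y)"
  shows "P x"
proof (cases "x < 0")
  case False
  then obtain i y where "x = u * real i + y" "0 \<le> y" "y < u"
    using cell_exists[OF assms(1), of x] by (auto simp: not_less)
  then show ?thesis using assms(3) by simp
qed (rule assms(2))

lemma cellmap_id: "u > 0 \<Longrightarrow> cellmap u id = id"
  by (rule ext, rule cell_induct[of u]) (auto simp: cellmap_neg cellmap_cell)

lemma cellmap_comp: "u > 0 \<Longrightarrow> cellmap u p \<circ> cellmap u q = cellmap u (p \<circ> q)"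
proof
  fix x assume u: "u > 0"
  show "(cellmap u p \<circ> cellmap u q) x = cellmap u (p \<circ> q) x"
    using u by (rule cell_induct[of u _ x]) (auto simp: cellmap_neg cellmap_cell)
qed

lemma bij_cellmap: "u > 0 \<Longrightarrow> bij p \<Longrightarrow> bij (cellmap u p)"
  by (rule o_bij[of "cellmap u (inv p)"])
     (simp_all add: cellmap_comp cellmap_id bij_is_inj bij_is_surj flip: surj_iff, simp_all add: bij_is_surj surj_iff[THEN iffD1] cellmap_id)

lemma inv_cellmap: "u > 0 \<Longrightarrow> bij p \<Longrightarrow> inv (cellmap u p) = cellmap u (inv p)"
  by (rule inv_unique_comp)
     (simp_all add: cellmap_comp cellmap_id bij_is_inj bij_is_surj flip: surj_iff, simp_all add: bij_is_surj surj_iff[THEN iffD1] cellmap_id)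

lemma isometric_at_cellmap_inner:
  assumes u: "u > 0" and x: "\<And>i. x \<noteq> u * real i" shows "isometric_at (cellmap u p) x"
proof (cases "x < 0")
  case True
  then show ?thesis
    by (intro isometric_at_affineI[of "{..<0}" x 1 _ 0]) (auto simp: cellmap_neg)
next
  case False
  then obtain i y where xy: "x = u * real i + y" "0 \<le> y" "y < u"
    using cell_exists[OF u, of x] by auto
  moreover have "y \<noteq> 0" using x[of i] xy by auto
  ultimately have "x \<in> {u * real i<..<u * real i + u}" by auto
  then show ?thesis
    using cellmap_cell[of "z - u * real i" u p i for z]
    by (intro isometric_at_affineI[of "{u * real i<..<u * real i + u}" x 1 _ "u * real (p i) - u * real i"])
      (auto simp: algebra_simps)
qed

lemma isometric_at_cellmap_grid:
  assumes u: "u > 0" and p: "p (Suc i) = Suc (p i)" shows "isometric_at (cellmap u p) (u * real (Suc i))"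
proof -
  have *: "cellmap u p z = 1 * z + (u * real (p i) - u * real i)"
    if z: "z \<in> {u * real i<..<u * real (Suc i) + u}" for z
  proof (cases "z < u * real (Suc i)")
    case True
    then show ?thesis using z cellmap_cell[of "z - u * real i" u p i] by (simp add: algebra_simps)
  next
    case False
    then show ?thesis using z p cellmap_cell[of "z - u * real (Suc i)" u p "Suc i"] by (simp add: algebra_simps)
  qed
  show ?thesis 
    by (rule isometric_at_affineI[OF open_greaterThanLessThan _ _ *]) (use u in \<open>auto simp: algebra_simps\<close>)
qed

text \<open>A grid point between two cells that stay adjacent in the same order is not a break.\<close>

lemma breaks_cellmap:
  assumes u: "u > 0" and p: "p permutes {..<n}"
  shows "breaks (cellmap u p) \<subseteq> (\<lambda>j. u * real j) ` {j. j \<le> n \<and> (\<forall>i. j = Suc i \<longrightarrow> p j \<noteq> Suc (p i))}"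
proof
  fix x assume "x \<in> breaks (cellmap u p)"
  then have nl: "\<not> isometric_at (cellmap u p) x" by (simp add: breaks_def)
  then obtain j where j: "x = u * real j" using isometric_at_cellmap_inner[OF u] by blast
  have np: "\<forall>i. j = Suc i \<longrightarrow> p j \<noteq> Suc (p i)" using nl j isometric_at_cellmap_grid[OF u] by blast
  moreover have "j \<le> n"
  proof (rule ccontr)
    assume "\<not> j \<le> n"
    then obtain i where "j = Suc i" "i \<notin> {..<n}" "j \<notin> {..<n}" by (cases j) auto
    then show False using np permutes_not_in[OF p] by metis
  qed
  ultimately show "x \<in> (\<lambda>j. u * real j) ` {j. j \<le> n \<and> (\<forall>i. j = Suc i \<longrightarrow> p j \<noteq> Suc (p i))}"
    using j by blast
qed

lemma cellmap_PIso:
  assumes u: "u > 0" "u * real n \<le> 1" and p: "p permutes {..<n}" shows "cellmap u p \<in> PIso"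
proof -
  have "finite (breaks (cellmap u p))"
    by (rule finite_subset[OF breaks_cellmap[OF u(1) p]]) simp
  moreover have "cellmap u p x = x" if x: "x \<notin> {0..<1}" for x
  proof (cases "x < 0")
    case False
    then obtain i y where xy: "x = u * real i + y" "0 \<le> y" "y < u"
      using cell_exists[OF u(1), of x] by auto
    have "i \<ge> n"
    proof (rule ccontr)
      assume "\<not> i \<ge> n"
      then have "u * (real i + 1) \<le> u * real n" using u(1) by (intro mult_left_mono) auto
      then show False using xy x u False by (auto simp: algebra_simps)
    qed
    then show ?thesis using xy permutes_not_in[OF p] by (auto simp: cellmap_cell)
  qed (simp add: cellmap_neg)
  ultimately show ?thesis using bij_cellmap[OF u(1) permutes_bij[OF p]] by (auto simp: PIso_def)
qed

lemma bij_permutes: "bij p \<Longrightarrow> (\<And>x. x \<notin> S \<Longrightarrow> p x = x) \<Longrightarrow> p permutes S"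
  by (auto simp: permutes_def bij_iff)

text \<open>A permutation is conjugate to its inverse by an involution: fix a representative \<open>y\<close> of each orbit and
exchange \<open>p\<^sup>k y\<close> with \<open>p\<^sup>-\<^sup>k y\<close>. Writing \<open>q\<close> for the inverse of \<open>p\<close> and using that \<open>p\<close> has finite order,
all exponents are natural numbers.\<close>

lemma reversing_involution:
  fixes p :: "nat \<Rightarrow> nat"
  assumes p: "p permutes S" "finite S"
  shows "\<exists>t. t permutes S \<and> t \<circ> t = id \<and> t \<circ> p = inv p \<circ> t"
proof -
  obtain N where N: "N > 0" "p ^^ N = id"
    using permutation_is_nilpotent permutation_permutes p by blast
  have bij: "bij p" using p(1) by (rule permutes_bij)
  define q where "q = inv p"
  have qp: "q (p x) = x" "p (q x) = x" for x
    using bij by (auto simp: q_def bij_is_inj bij_is_surj surj_f_inv_f)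
  have qpow: "(q ^^ k) ((p ^^ k) x) = x" "(p ^^ k) ((q ^^ k) x) = x" for k x
    by (induction k arbitrary: x) (auto simp: funpow_swap1 qp)
  have q_eq: "q ^^ k = p ^^ ((N - 1) * k)" for k
  proof
    fix x
    have "(p ^^ k) ((p ^^ ((N - 1) * k)) x) = (p ^^ (N * k)) x"
      using N by (cases N) (auto simp: funpow_add)
    also have "\<dots> = x" using N(2) by (simp add: funpow_mult[symmetric] id_funpow)
    finally have "(q ^^ k) ((p ^^ k) ((p ^^ ((N - 1) * k)) x)) = (q ^^ k) x" by simp
    then show "(q ^^ k) x = (p ^^ ((N - 1) * k)) x" by (simp add: qpow)
  qed
  define orb where "orb x = {y. \<exists>k. x = (p ^^ k) y}" for x
  define rep where "rep x = (LEAST y. y \<in> orb x)" for x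
  have rep: "rep x \<in> orb x" for x
    unfolding rep_def by (rule LeastI[of _ x]) (auto simp: orb_def intro: exI[of _ 0])
  have orb_p: "orb (p x) = orb x" for x
  proof (intro equalityI subsetI)
    fix y assume "y \<in> orb x"
    then obtain k where "x = (p ^^ k) y" by (auto simp: orb_def)
    then have "p x = (p ^^ Suc k) y" by simp
    then show "y \<in> orb (p x)" unfolding orb_def by blast
  next
    fix y assume "y \<in> orb (p x)"
    then obtain k where "p x = (p ^^ k) y" by (auto simp: orb_def)
    then have "(p ^^ (N - 1 + k)) y = (p ^^ Suc (N - 1)) x" by (simp add: funpow_add funpow_swap1)
    then have "x = (p ^^ (N - 1 + k)) y" using N by simp
    then show "y \<in> orb x" unfolding orb_def by blast
  qed
  then have rep_p: "rep ((p ^^ k) x) = rep x" for k x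
    by (induction k) (auto simp: rep_def)
  define t where "t x = (q ^^ (SOME k. x = (p ^^ k) (rep x))) (rep x)" for x
  have t_eq: "t x = (q ^^ k) (rep x)" if k: "x = (p ^^ k) (rep x)" for x k
  proof -
    define l where "l = (SOME k. x = (p ^^ k) (rep x))"
    have l: "x = (p ^^ l) (rep x)" unfolding l_def by (rule someI[of _ k]) (rule k)
    have "(q ^^ l) (rep x) = (q ^^ (l + k)) ((p ^^ k) (rep x))" by (simp add: funpow_add qpow)
    also have "\<dots> = (q ^^ (k + l)) ((p ^^ l) (rep x))" using k l by (simp add: add.commute)
    also have "\<dots> = (q ^^ k) (rep x)" by (simp add: funpow_add qpow)
    finally show ?thesis by (simp add: t_def l_def)
  qed
  have ex: "\<exists>k. x = (p ^^ k) (rep x)" for x using rep[of x] by (simp add: orb_def)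
  have tt: "t (t x) = x" for x
  proof -
    obtain k where k: "x = (p ^^ k) (rep x)" using ex by blast
    have t: "t x = (p ^^ ((N - 1) * k)) (rep x)" using t_eq[OF k] by (simp add: q_eq)
    then have r: "rep (t x) = rep x" using rep_p[of "(N - 1) * k" "rep x"] rep_p[of k "rep x"] k by metis
    then have "t (t x) = (q ^^ ((N - 1) * k)) (rep x)" using t_eq[of "t x" "(N - 1) * k"] t by simp
    also have "\<dots> = x"
    proof -
      have "(p ^^ ((N - 1) * k)) x = (q ^^ k) x" by (simp add: q_eq)
      also have "\<dots> = rep x" using k qpow(1) by metis
      finally show ?thesis using qpow(1) by metis
    qed
    finally show ?thesis .
  qed
  have tp: "t (p x) = q (t x)" for x
  proof -
    obtain k where k: "x = (p ^^ k) (rep x)" using ex by blast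
    have r: "rep (p x) = rep x" using rep_p[of 1 x] by simp
    have "p x = (p ^^ Suc k) (rep (p x))" using k r by simp
    then have "t (p x) = (q ^^ Suc k) (rep x)" using t_eq[of "p x" "Suc k"] r by simp
    then show ?thesis using t_eq[OF k] by simp
  qed
  have "t x = x" if "x \<notin> S" for x
  proof -
    obtain k where k: "x = (p ^^ k) (rep x)" using ex by blast
    have "q x = x" using permutes_not_in[OF p(1) that] qp by metis
    then have qk: "(q ^^ k) x = x" for k by (induction k) auto
    then have "rep x = x" using k qpow(1) by metis
    then show ?thesis using t_eq[OF k] qk by simp
  qed
  moreover have "bij t" by (rule o_bij[of t]) (auto simp: tt)
  ultimately have "t permutes S" by (auto intro: bij_permutes)
  then show ?thesis using tt tp by (intro exI[of _ t]) (auto simp: q_def)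
qed

section \<open>Products with disjoint supports\<close>

lemma commutI:
  assumes "bij a" "bij b" "f \<circ> b \<circ> a = a \<circ> b" shows "f = commut a b"
proof
  fix x
  have "f x = (f \<circ> b \<circ> a) (inv a (inv b x))"
    using assms(1,2) by (simp add: bij_is_surj surj_f_inv_f)
  then show "f x = commut a b x" by (simp add: assms(3) commut_def)
qed

text \<open>The composition of the maps \<open>a 0, \<dots>, a (n - 1)\<close>, mostly used when these have disjoint supports and
therefore commute.\<close>

primrec compose_upto :: "(nat \<Rightarrow> real \<Rightarrow> real) \<Rightarrow> nat \<Rightarrow> real \<Rightarrow> real" where
  "compose_upto a 0 = id"
| "compose_upto a (Suc n) = compose_upto a n \<circ> a n"

text \<open>Bijections of the line that fix all points outside \<open>X\<close>, and hence preserve \<open>X\<close>.\<close>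

definition supported :: "(real \<Rightarrow> real) \<Rightarrow> real set \<Rightarrow> bool" where
  "supported f X \<longleftrightarrow> bij f \<and> (\<forall>x. x \<notin> X \<longrightarrow> f x = x)"

lemma supportedD:
  assumes "supported f X" shows "bij f" "x \<notin> X \<Longrightarrow> f x = x" "f x \<in> X \<longleftrightarrow> x \<in> X"
  using assms bij_preserves_support[of f X x] by (auto simp: supported_def)

lemma supported_comp: "supported f X \<Longrightarrow> supported g X \<Longrightarrow> supported (f \<circ> g) X"
  by (auto simp: supported_def bij_comp)

lemma supported_inv: "supported f X \<Longrightarrow> supported (inv f) X"
  unfolding supported_def by (metis bij_imp_bij_inv bij_inv_eq_iff)

lemma supported_commut: "supported f X \<Longrightarrow> supported g X \<Longrightarrow> supported (commut f g) X"
  unfolding commut_def by (intro supported_comp supported_inv)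

lemma supported_flip: "{a<..<b} \<subseteq> X \<Longrightarrow> supported (flip a b) X"
  by (auto simp: supported_def flip_def)

lemma compose_upto_outside: "(\<And>k. k < n \<Longrightarrow> a k x = x) \<Longrightarrow> compose_upto a n x = x"
  by (induction n) auto

lemma compose_upto_at:
  assumes "\<And>k. k < n \<Longrightarrow> supported (a k) (Z k)" "disjoint_family_on Z {..<n}" "k < n" "x \<in> Z k"
  shows "compose_upto a n x = a k x"
  using assms
proof (induction n)
  case (Suc n)
  have dis: "z \<notin> Z j" if "z \<in> Z i" "i < Suc n" "j < Suc n" "i \<noteq> j" for i j z
    using Suc.prems(2) that by (auto simp: disjoint_family_on_def)
  show ?case
  proof (cases "k = n")
    case True
    have "a n x \<in> Z n" using supportedD(3)[OF Suc.prems(1)[of n]] Suc.prems(4) True by simp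
    then have "a i (a n x) = a n x" if "i < n" for i
      using supportedD(2)[OF Suc.prems(1)[of i]] dis[of _ n i] that by auto
    then show ?thesis using compose_upto_outside[of n a "a n x"] True by simp
  next
    case False
    then have "a n x = x" using supportedD(2)[OF Suc.prems(1)[of n]] dis[of x k n] Suc.prems by auto
    moreover have "compose_upto a n x = a k x"
      using Suc.prems False by (intro Suc.IH) (auto simp: disjoint_family_on_def)
    ultimately show ?thesis by simp
  qed
qed simp

lemma compose_upto_PIso: "(\<And>k. k < n \<Longrightarrow> a k \<in> PIso) \<Longrightarrow> compose_upto a n \<in> PIso"
  by (induction n) auto

lemma compose_upto_fin_eq:
  "(\<And>k. k < n \<Longrightarrow> a k \<approx>\<^sub>f b k \<and> bij (b k)) \<Longrightarrow> compose_upto a n \<approx>\<^sub>f compose_upto b n"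
  by (induction n) (auto intro!: fin_eq_comp bij_is_inj)

lemma compose_upto_comp:
  assumes "\<And>k. k < n \<Longrightarrow> supported (a k) (Z k)" "\<And>k. k < n \<Longrightarrow> supported (b k) (Z k)"
    and "disjoint_family_on Z {..<n}"
  shows "compose_upto (\<lambda>k. a k \<circ> b k) n = compose_upto a n \<circ> compose_upto b n"
proof
  fix x
  show "compose_upto (\<lambda>k. a k \<circ> b k) n x = (compose_upto a n \<circ> compose_upto b n) x"
  proof (cases "\<exists>k<n. x \<in> Z k")
    case True
    then obtain k where k: "k < n" "x \<in> Z k" by blast
    then have "b k x \<in> Z k" using supportedD(3)[OF assms(2)] by blast
    then show ?thesis
      using compose_upto_at[where Z = Z, OF _ assms(3) k(1)] k assms by (simp add: supported_comp)
  next
    case False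
    then have "a k x = x" "b k x = x" if "k < n" for k
      using supportedD(2) assms that by blast+
    then show ?thesis by (simp add: compose_upto_outside)
  qed
qed

lemma compose_upto_inv:
  assumes "\<And>k. k < n \<Longrightarrow> supported (a k) (Z k)" "disjoint_family_on Z {..<n}"
  shows "compose_upto (\<lambda>k. inv (a k)) n = inv (compose_upto a n)"
proof -
  have *: "compose_upto c n = id" if "\<And>k. k < n \<Longrightarrow> c k = id" for c
    using that by (induction n) auto
  have b: "bij (a k)" if "k < n" for k using assms(1)[OF that] by (simp add: supported_def)
  have "compose_upto (\<lambda>k. inv (a k)) n \<circ> compose_upto a n = compose_upto (\<lambda>k. inv (a k) \<circ> a k) n"
    by (rule compose_upto_comp[symmetric, where Z = Z]) (auto intro: supported_inv assms)
  moreover have "compose_upto a n \<circ> compose_upto (\<lambda>k. inv (a k)) n = compose_upto (\<lambda>k. a k \<circ> inv (a k)) n"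
    by (rule compose_upto_comp[symmetric, where Z = Z]) (auto intro: supported_inv assms)
  ultimately show ?thesis
    using b by (intro inv_unique_comp[symmetric])
      (auto intro!: * simp: bij_is_inj bij_is_surj simp flip: surj_iff)
qed

text \<open>A product of commutators with disjoint supports is a single commutator.\<close>

lemma compose_upto_commut:
  assumes "\<And>k. k < n \<Longrightarrow> supported (a k) (Z k)" "\<And>k. k < n \<Longrightarrow> supported (b k) (Z k)"
    and "disjoint_family_on Z {..<n}"
  shows "compose_upto (\<lambda>k. commut (a k) (b k)) n = commut (compose_upto a n) (compose_upto b n)"
proof -
  have "compose_upto (\<lambda>k. a k \<circ> b k \<circ> inv (a k) \<circ> inv (b k)) n =
      compose_upto (\<lambda>k. a k \<circ> b k \<circ> inv (a k)) n \<circ> compose_upto (\<lambda>k. inv (b k)) n"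
    by (rule compose_upto_comp[where Z = Z]) (auto intro!: supported_inv supported_comp assms)
  also have "compose_upto (\<lambda>k. a k \<circ> b k \<circ> inv (a k)) n = compose_upto (\<lambda>k. a k \<circ> b k) n \<circ> compose_upto (\<lambda>k. inv (a k)) n"
    by (rule compose_upto_comp[where Z = Z]) (auto intro!: supported_inv supported_comp assms)
  also have "compose_upto (\<lambda>k. a k \<circ> b k) n = compose_upto a n \<circ> compose_upto b n"
    by (rule compose_upto_comp[where Z = Z]) (auto intro!: supported_inv supported_comp assms)
  finally show ?thesis
    by (simp only: commut_def compose_upto_inv[where Z = Z, OF assms(1,3)] compose_upto_inv[where Z = Z, OF assms(2,3)])
qed

text \<open>The simultaneous flip of the intervals \<open>(a k, b k)\<close>, \<open>k < n\<close>, when these are disjoint.\<close>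

definition mflip :: "nat \<Rightarrow> (nat \<Rightarrow> real) \<Rightarrow> (nat \<Rightarrow> real) \<Rightarrow> real \<Rightarrow> real" where
  "mflip n a b = compose_upto (\<lambda>k. flip (a k) (b k)) n"

text \<open>Cut \<open>(a, b)\<close> into quarters. The flip exchanges the outer quarters with each other and the inner ones
with each other; \<open>s\<close>, the flip of \<open>(a, b)\<close> composed with that of its middle half, does only the former. The
flips of the two halves conjugate \<open>s\<close> to the exchange of the inner quarters. As all maps involved are
involutions, the flip agrees with the commutator of \<open>s\<close> and the flip of both halves, except at some
end points of the quarters.\<close>

lemma flip_commut:
  fixes a b :: real
  defines "m \<equiv> (a + b) / 2" and "d \<equiv> (b - a) / 4"
  shows "flip a b \<approx>\<^sub>f commut (flip a b \<circ> flip (a + d) (b - d)) (flip a m \<circ> flip m b)"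
proof (cases "a < b")
  case True
  have d: "d > 0" "m = a + 2 * d" "b = a + 4 * d" using True by (auto simp: d_def m_def field_simps)
  have 1: "flip (a + d) (b - d) \<circ> flip a b = flip a b \<circ> flip (a + d) (b - d)"
    using d(1) unfolding d(2,3) by (auto simp: flip_def fun_eq_iff)
  have 2: "flip m b \<circ> flip a m = flip a m \<circ> flip m b"
    using d(1) unfolding d(2,3) by (auto simp: flip_def fun_eq_iff)
  have ii: "inv (flip a b \<circ> flip (a + d) (b - d)) = flip a b \<circ> flip (a + d) (b - d)"
    "inv (flip a m \<circ> flip m b) = flip a m \<circ> flip m b"
    by (simp_all add: o_inv_distrib 1 2)
  define r where "r = (\<lambda>x. flip a b (flip (a + d) (b - d) x))"
  define h where "h = (\<lambda>x. flip a m (flip m b x))"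
  have r: "r x = (if a < x \<and> x \<le> a + d \<or> a + 3 * d \<le> x \<and> x < b then 2 * a + 4 * d - x else x)" for x
    unfolding r_def flip_def d by (auto simp: algebra_simps)
  have h: "h x = (if a < x \<and> x < a + 2 * d then 2 * a + 2 * d - x
      else if a + 2 * d < x \<and> x < b then 2 * a + 6 * d - x else x)" for x
    unfolding h_def flip_def d using d(1) by auto
  have "flip a b x = r (h (r (h x)))" if nx: "x \<notin> {a, a + d, a + 2 * d, a + 3 * d, b}" for x
  proof -
    consider "x < a" | "a < x" "x < a + d" | "a + d < x" "x < a + 2 * d" | "a + 2 * d < x" "x < a + 3 * d"
      | "a + 3 * d < x" "x < a + 4 * d" | "b < x" using nx d(3) by force
    then show ?thesis
    proof cases
      case 1 then have "h x = x" "r x = x" using d by (auto simp: h r)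
      then show ?thesis using 1 by (auto simp: flip_def)
    next
      case 2 
      then have "h x = 2 * a + 2 * d - x" by (auto simp: h)
      moreover have "r (2 * a + 2 * d - x) = 2 * a + 2 * d - x" using 2 d by (auto simp: r)
      moreover have "h (2 * a + 2 * d - x) = x" using 2 d by (auto simp: h)
      moreover have "r x = 2 * a + 4 * d - x" using 2 by (auto simp: r)
      ultimately show ?thesis using 2 d by (auto simp: flip_def)
    next
      case 3
      then have "h x = 2 * a + 2 * d - x" using d by (auto simp: h)
      moreover have "r (2 * a + 2 * d - x) = 2 * d + x" using 3 d by (auto simp: r)
      moreover have "h (2 * d + x) = 2 * a + 4 * d - x" using 3 d by (auto simp: h)
      moreover have "r (2 * a + 4 * d - x) = 2 * a + 4 * d - x" using 3 d by (auto simp: r)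
      ultimately show ?thesis using 3 d by (auto simp: flip_def)
    next
      case 4
      then have "h x = 2 * a + 6 * d - x" using d by (auto simp: h)
      moreover have "r (2 * a + 6 * d - x) = x - 2 * d" using 4 d by (auto simp: r)
      moreover have "h (x - 2 * d) = 2 * a + 4 * d - x" using 4 d by (auto simp: h)
      moreover have "r (2 * a + 4 * d - x) = 2 * a + 4 * d - x" using 4 d by (auto simp: r)
      ultimately show ?thesis using 4 d by (auto simp: flip_def)
    next
      case 5
      then have "h x = 2 * a + 6 * d - x" using d by (auto simp: h)
      moreover have "r (2 * a + 6 * d - x) = 2 * a + 6 * d - x" using 5 d by (auto simp: r)
      moreover have "h (2 * a + 6 * d - x) = x" using 5 d by (auto simp: h)
      moreover have "r x = 2 * a + 4 * d - x" using 5 d by (auto simp: r)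
      ultimately show ?thesis using 5 d by (auto simp: flip_def)
    next
      case 6 then have "h x = x" "r x = x" using d by (auto simp: h r)
      then show ?thesis using 6 by (auto simp: flip_def)
    qed
  qed
  then show ?thesis
    unfolding commut_def ii
    by (intro fin_eqI[of "{a, a + d, a + 2 * d, a + 3 * d, b}"]) (auto simp: r_def h_def)
next
  case False
  have [simp]: "flip x y = id" if "y \<le> x" for x y using that by (auto simp: flip_def fun_eq_iff)
  show ?thesis using False by (simp add: commut_def m_def d_def)
qed

lemma mflip_PIso: "(\<And>k. k < n \<Longrightarrow> 0 \<le> a k \<and> b k \<le> 1) \<Longrightarrow> mflip n a b \<in> PIso"
  unfolding mflip_def by (intro compose_upto_PIso flip_PIso) auto

lemma mflip_Comms:
  assumes ab: "\<And>k. k < n \<Longrightarrow> 0 \<le> a k \<and> b k \<le> 1" and dis: "disjoint_family_on (\<lambda>k. {a k<..<b k}) {..<n}"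
  shows "mflip n a b \<in> Comms"
proof -
  define m d where "m k = (a k + b k) / 2" and "d k = (b k - a k) / 4" for k
  define s where "s k = flip (a k) (b k) \<circ> flip (a k + d k) (b k - d k)" for k
  define h where "h k = flip (a k) (m k) \<circ> flip (m k) (b k)" for k
  have supp: "supported (s k) {a k<..<b k}" "supported (h k) {a k<..<b k}" for k
    unfolding s_def h_def
    by (intro supported_comp supported_flip; auto simp: m_def d_def field_simps)+
  have P: "s k \<in> PIso" "h k \<in> PIso" if "k < n" for k
  proof -
    have "f \<in> PIso" if "supported f {a k<..<b k}" "finite (breaks f)" for f
      using that ab[OF \<open>k < n\<close>] supportedD(2)[OF that(1)] by (auto simp: PIso_def supported_def)
    moreover have "finite (breaks (flip x y \<circ> flip z w))" for x y z w
      by (rule finite_subset[OF breaks_comp])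
        (auto intro!: finite_vimageI bij_is_inj finite_subset[OF breaks_flip])
    ultimately show "s k \<in> PIso" "h k \<in> PIso" using supp by (auto simp: s_def h_def)
  qed
  have "mflip n a b \<approx>\<^sub>f compose_upto (\<lambda>k. commut (s k) (h k)) n"
    unfolding mflip_def
  proof (rule compose_upto_fin_eq, rule conjI)
    fix k assume "k < n"
    show "flip (a k) (b k) \<approx>\<^sub>f commut (s k) (h k)"
      unfolding s_def h_def m_def d_def by (rule flip_commut)
    show "bij (commut (s k) (h k))" using supported_commut[OF supp] by (rule supportedD)
  qed
  also have "compose_upto (\<lambda>k. commut (s k) (h k)) n = commut (compose_upto s n) (compose_upto h n)"
    using supp dis by (intro compose_upto_commut)
  finally show ?thesis
    using ab P by (intro CommsI[OF mflip_PIso]) (auto intro: compose_upto_PIso)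
qed

lemma mflip_at:
  assumes "disjoint_family_on (\<lambda>k. {a k<..<b k}) {..<n}" "k < n" "x \<in> {a k<..<b k}"
  shows "mflip n a b x = a k + b k - x"
proof -
  have "mflip n a b x = flip (a k) (b k) x"
    unfolding mflip_def 
    by (rule compose_upto_at[where Z = "\<lambda>k. {a k<..<b k}"]) (use assms in \<open>auto intro: supported_flip\<close>)
  then show ?thesis using assms by (simp add: flip_def)
qed

lemma mflip_outside: "(\<And>k. k < n \<Longrightarrow> x \<notin> {a k<..<b k}) \<Longrightarrow> mflip n a b x = x"
  unfolding mflip_def by (intro compose_upto_outside flip_outside)

lemma mflip_mflip:
  assumes "disjoint_family_on (\<lambda>k. {a k<..<b k}) {..<n}"
  shows "mflip n a b \<circ> mflip n a b = id"
proof -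
  have "mflip n a b \<circ> mflip n a b = compose_upto (\<lambda>k. flip (a k) (b k) \<circ> flip (a k) (b k)) n"
    unfolding mflip_def
    by (rule compose_upto_comp[symmetric, where Z = "\<lambda>k. {a k<..<b k}"]) (use assms in \<open>auto intro: supported_flip\<close>)
  also have "\<dots> = id" by (intro ext) (simp add: compose_upto_outside)
  finally show ?thesis .
qed

section \<open>Permutations of cells and short products of flips as commutators\<close>

lemma cellmap_halve:
  assumes "u > 0"
  shows "cellmap u p = cellmap (u/2) (\<lambda>j. 2 * p (j div 2) + j mod 2)"
proof
  fix x
  have "u / 2 > 0" using assms by simp
  then show "cellmap u p x = cellmap (u/2) (\<lambda>j. 2 * p (j div 2) + j mod 2) x"
  proof (induction x rule: cell_induct)
    case (neg x) then show ?case by (simp add: cellmap_neg)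
  next
    case (cell j y)
    have j: "real j = 2 * real (j div 2) + real (j mod 2)"
      by (metis mult_div_mod_eq of_nat_add of_nat_mult of_nat_numeral)
    then have eq: "u / 2 * real j + y = u * real (j div 2) + (u / 2 * real (j mod 2) + y)"
      by (simp add: algebra_simps)
    have "0 \<le> u / 2 * real (j mod 2) + y" "u / 2 * real (j mod 2) + y < u"
      using assms cell by (cases "even j"; simp add: odd_iff_mod_2_eq_one even_iff_mod_2_eq_zero)+
    then have "cellmap u p (u / 2 * real j + y) = u * real (p (j div 2)) + (u / 2 * real (j mod 2) + y)"
      unfolding eq by (rule cellmap_cell)
    then show ?case unfolding cellmap_cell[OF cell] by (simp add: algebra_simps)
  qed
qed

text \<open>Cut each cell into halves. Let \<open>s\<close> act as \<open>p\<close> on left halves only, and let \<open>h\<close> exchange the left half of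
the cell \<open>i\<close> with the right half of the cell \<open>t i\<close>, where the involution \<open>t\<close> conjugates \<open>p\<close> to its inverse. Then
\<open>h s\<inverse> h\<inverse>\<close> acts as \<open>p\<close> on right halves, so that the commutator of \<open>s\<close> and \<open>h\<close> is the permutation of cells
given by \<open>p\<close>.\<close>

lemma cellmap_Comms:
  assumes u: "u > 0" "u * real n \<le> 1" and p: "p permutes {..<n}" shows "cellmap u p \<in> Comms"
proof -
  obtain t where t: "t permutes {..<n}" "t \<circ> t = id" "t \<circ> p = inv p \<circ> t"
    using reversing_involution[OF p] by auto
  have bp: "bij p" using p by (rule permutes_bij)
  have pp: "inv p (p i) = i" "p (inv p i) = i" for i
    using bp by (auto simp: bij_is_inj bij_is_surj surj_f_inv_f)
  have tt: "t (t i) = i" for i using t(2) by (metis comp_apply id_apply)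
  have "t (p i) = inv p (t i)" for i using t(3) by (metis comp_apply)
  then have ptp: "p (t (p i)) = t i" for i by (simp add: pp)
  define q where "q j = 2 * p (j div 2) + j mod 2" for j
  define s where "s j = (if even j then 2 * p (j div 2) else j)" for j
  define s' where "s' j = (if even j then 2 * inv p (j div 2) else j)" for j
  define h where "h j = (if j < 2 * n then (if even j then 2 * t (j div 2) + 1 else 2 * t (j div 2)) else j)" for j
  have tn: "t i < n \<longleftrightarrow> i < n" for i using permutes_in_image[OF t(1), of i] by auto
  have pn: "p i < n \<longleftrightarrow> i < n" for i using permutes_in_image[OF p, of i] by auto
  have t2: "2 * t (j div 2) + 1 < 2 * n" if "j < 2 * n" for j using tn[of "j div 2"] that by linarith
  have hh: "h (h j) = j" for j using t2[of j] by (auto simp: h_def tt)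
  have ss: "s (s' j) = j" "s' (s j) = j" for j by (auto simp: s_def s'_def pp)
  have "bij h" by (rule o_bij[of h]) (auto simp: hh)
  have "bij s" by (rule o_bij[of s']) (auto simp: ss)
  have s: "s permutes {..<2 * n}"
  proof (rule bij_permutes[OF \<open>bij s\<close>])
    fix j assume "j \<notin> {..<2 * n}"
    then have "p (j div 2) = j div 2" by (intro permutes_not_in[OF p]) auto
    then show "s j = j" by (auto simp: s_def)
  qed
  have h: "h permutes {..<2 * n}" by (rule bij_permutes[OF \<open>bij h\<close>]) (simp add: h_def)
  have "q (h (s j)) = s (h j)" for j
  proof (cases "j < 2 * n")
    case True
    then have "2 * p (j div 2) < 2 * n" using pn[of "j div 2"] by linarith
    then show ?thesis using True by (auto simp: q_def h_def s_def ptp)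
  next
    case False
    then have "p (j div 2) = j div 2" by (intro permutes_not_in[OF p]) auto
    then have "q j = j" "s j = j" "h j = j" using False by (simp_all add: q_def h_def s_def)
    then show ?thesis by simp
  qed
  then have qhs: "q \<circ> h \<circ> s = s \<circ> h" by auto
  have u2: "u / 2 > 0" "u / 2 * real (2 * n) \<le> 1" using u by auto
  have "cellmap (u/2) q \<circ> cellmap (u/2) h \<circ> cellmap (u/2) s = cellmap (u/2) s \<circ> cellmap (u/2) h"
    using u2(1) by (simp add: cellmap_comp qhs)
  then have "cellmap (u/2) q = commut (cellmap (u/2) s) (cellmap (u/2) h)"
    using u2(1) \<open>bij s\<close> \<open>bij h\<close> by (intro commutI bij_cellmap)
  also have "\<dots> \<in> Comms" using u2 s h by (intro commut_Comms cellmap_PIso)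
  finally show ?thesis using cellmap_halve[OF u(1), of p] by (simp add: q_def[abs_def])
qed

lemma flips_shift: "flips (map (\<lambda>p. (fst p + c, snd p + c)) ps) (x + c) = flips ps x + c"
  by (induction ps) (auto simp: flip_def)

lemma flips_PIso: "(\<And>p. p \<in> set ps \<Longrightarrow> 0 \<le> fst p \<and> snd p \<le> 1) \<Longrightarrow> flips ps \<in> PIso"
  by (induction ps) (auto intro!: PIso_comp flip_PIso)

lemma supported_flips: "(\<And>p. p \<in> set ps \<Longrightarrow> l \<le> fst p \<and> snd p \<le> L) \<Longrightarrow> supported (flips ps) {l..<L}"
proof (induction ps)
  case Nil show ?case using bij_id by (auto simp: supported_def id_def)
next
  case (Cons p ps)
  have "{fst p<..<snd p} \<subseteq> {l..<L}" using Cons.prems[of p] by auto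
  then show ?case unfolding flips.simps
    by (intro supported_comp supported_flip Cons.IH Cons.prems) simp_all
qed

text \<open>A product \<open>s\<^sub>1 \<dots> s\<^sub>N\<close> of \<open>N\<close> flips in \<open>[0, u)\<close> is a product of two commutators once there is room for
\<open>N + 1\<close> disjoint copies of \<open>[0, u)\<close>, the blocks \<open>[u i, u (i + 1))\<close> for \<open>i \<le> N\<close>. Let \<open>h\<close> permute the blocks
cyclically and let \<open>F\<close> act on the \<open>i\<close>-th block as \<open>s\<^sub>i\<^sub>+\<^sub>1 \<dots> s\<^sub>N\<close>. Then \<open>F h F\<inverse> h\<inverse>\<close> acts on the block
\<open>0\<close> as \<open>s\<^sub>1 \<dots> s\<^sub>N\<close> and on the block \<open>i > 0\<close> as \<open>s\<^sub>i\<close>. The latter factors form a simultaneous flip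
\<open>D\<close> of disjoint intervals, which is one further commutator.\<close>

lemma flips_two_commut:
  assumes u: "u > 0" "u * (real (length ps) + 1) \<le> 1"
    and ps: "\<And>p. p \<in> set ps \<Longrightarrow> 0 \<le> fst p \<and> snd p \<le> u"
  shows "\<exists>C\<in>Comms. \<exists>D\<in>Comms. flips ps = C \<circ> D"
proof -
  define N where "N = length ps"
  define sh where "sh i qs = map (\<lambda>p. (fst p + u * real i, snd p + u * real i)) qs" for i and qs :: "(real \<times> real) list"
  define Z where "Z i = {u * real i..<u * real i + u}" for i
  have Zdis: "i = j" if "x \<in> Z i" "x \<in> Z j" for i j x
  proof -
    have "nat \<lfloor>(u * real i + (x - u * real i)) / u\<rfloor> = i" "nat \<lfloor>(u * real j + (x - u * real j)) / u\<rfloor> = j"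
      using that by (intro cell_index; auto simp: Z_def)+
    then show ?thesis by simp
  qed
  then have dis: "disjoint_family_on Z I" for I by (auto simp: disjoint_family_on_def)
  have Zle: "u * real i + u \<le> 1" if "i \<le> N" for i
  proof -
    have "u * (real i + 1) \<le> u * (real N + 1)" using u(1) that by (intro mult_left_mono) auto
    then show ?thesis using u(2) by (simp add: N_def algebra_simps)
  qed
  have u1: "u \<le> 1" using Zle[of 0] by simp
  have Zi: "u * real i + y \<in> Z i" if "0 \<le> y" "y < u" for i y using that by (simp add: Z_def)
  define a where "a i = flips (sh i (drop i ps))" for i
  have supp: "supported (a i) (Z i)" for i
    unfolding a_def Z_def using ps by (intro supported_flips) (auto simp: sh_def dest!: in_set_dropD)
  have a: "a i (u * real i + y) = u * real i + flips (drop i ps) y" for i y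
    unfolding a_def sh_def using flips_shift[of "u * real i" "drop i ps" y] by (simp add: add.commute)
  define F where "F = compose_upto a N"
  have FP: "F \<in> PIso"
    unfolding F_def
  proof (rule compose_upto_PIso)
    fix i assume "i < N"
    then show "a i \<in> PIso" unfolding a_def using ps Zle[of i] u(1)
      by (intro flips_PIso) (force simp: sh_def dest!: in_set_dropD)
  qed
  have F: "F (u * real i + y) = u * real i + flips (drop i ps) y" if y: "0 \<le> y" "y < u" for i y
  proof (cases "i < N")
    case True
    then show ?thesis unfolding F_def using compose_upto_at[of N a Z, OF supp dis True Zi[OF y]] a by simp
  next
    case False
    have "F (u * real i + y) = u * real i + y"
      unfolding F_def using Zi[OF y] Zdis False by (intro compose_upto_outside supportedD(2)[OF supp]) blast
    then show ?thesis using False by (simp add: N_def)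
  qed
  define D where "D = mflip N (\<lambda>k. fst (ps ! k) + u * real (Suc k)) (\<lambda>k. snd (ps ! k) + u * real (Suc k))"
  have psk: "0 \<le> fst (ps ! k)" "snd (ps ! k) \<le> u" if "k < N" for k
    using ps that by (auto simp: N_def)
  have suppD: "supported (flip (fst (ps ! k) + u * real (Suc k)) (snd (ps ! k) + u * real (Suc k))) (Z (Suc k))"
    if "k < N" for k using psk[OF that] by (intro supported_flip) (auto simp: Z_def)
  have disD: "disjoint_family_on (\<lambda>k. {fst (ps ! k) + u * real (Suc k)<..<snd (ps ! k) + u * real (Suc k)}) {..<N}"
    unfolding disjoint_family_on_def
  proof (intro ballI impI equals0I; elim IntE)
    fix i j x assume ij: "i \<in> {..<N}" "j \<in> {..<N}" "i \<noteq> j" 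
      and x: "x \<in> {fst (ps ! i) + u * real (Suc i)<..<snd (ps ! i) + u * real (Suc i)}"
        "x \<in> {fst (ps ! j) + u * real (Suc j)<..<snd (ps ! j) + u * real (Suc j)}"
    then have "x \<in> Z (Suc i)" "x \<in> Z (Suc j)" using psk[of i] psk[of j] by (auto simp: Z_def)
    then show False using Zdis ij by auto
  qed
  have DC: "D \<in> Comms"
    unfolding D_def
  proof (rule mflip_Comms[OF _ disD])
    fix k assume k: "k < N"
    show "0 \<le> fst (ps ! k) + u * real (Suc k) \<and> snd (ps ! k) + u * real (Suc k) \<le> 1"
      using psk[OF k] Zle[of "Suc k"] k u(1) by auto
  qed
  have D0: "D x = x" if "x \<notin> \<Union> (Z ` {1..N})" for x
    unfolding D_def mflip_def using that
    by (intro compose_upto_outside supportedD(2)[OF suppD]) auto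
  have DS: "D (u * real (Suc k) + y) = u * real (Suc k) + flip (fst (ps ! k)) (snd (ps ! k)) y"
    if "k < N" "0 \<le> y" "y < u" for k y
  proof -
    have "D (u * real (Suc k) + y) = 
        flip (fst (ps ! k) + u * real (Suc k)) (snd (ps ! k) + u * real (Suc k)) (u * real (Suc k) + y)"
      unfolding D_def mflip_def
      using dis[of "{1..N}"] that
      by (intro compose_upto_at[where Z = "\<lambda>k. Z (Suc k)"] suppD Zi) (auto simp: disjoint_family_on_def)
    then show ?thesis by (auto simp: flip_def)
  qed
  define c where "c i = (if i < N then Suc i else if i = N then 0 else i)" for i
  have "bij c"
    by (rule o_bij[of "\<lambda>i. if i = 0 then N else if i \<le> N then i - 1 else i"]) (auto simp: c_def fun_eq_iff)
  then have c: "c permutes {..<Suc N}" by (rule bij_permutes) (auto simp: c_def)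
  define h where "h = cellmap u c"
  have hP: "h \<in> PIso"
    unfolding h_def using u c by (intro cellmap_PIso[of u "Suc N"]) (auto simp: N_def algebra_simps)
  have fl: "0 \<le> flips qs y" "flips qs y < u" if "0 \<le> y" "y < u" "set qs \<subseteq> set ps" for qs y
    using supportedD(3)[OF supported_flips[of qs 0 u], of y] ps that by auto
  have fl_out: "flips ps x = x" if "x \<notin> {0..<u}" for x
    using supportedD(2)[OF supported_flips[of ps 0 u]] ps that by auto
  have neg: "x \<notin> Z i" if "x < 0" for x i using that u(1) by (auto simp: Z_def not_le intro: less_le_trans)
  have eq: "(flips ps \<circ> D \<circ> h \<circ> F) x = (F \<circ> h) x" for x
    using u(1)
  proof (induction x rule: cell_induct)
    case (neg x)
    have "F x = x" unfolding F_def by (intro compose_upto_outside supportedD(2)[OF supp] assms \<open>\<And>x i. x < 0 \<Longrightarrow> x \<notin> Z i\<close> neg)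
    moreover have "h x = x" using neg by (simp add: h_def cellmap_neg)
    moreover have "D x = x" using \<open>\<And>x i. x < 0 \<Longrightarrow> x \<notin> Z i\<close> neg by (intro D0) auto
    ultimately show ?case using fl_out[of x] neg by simp
  next
    case (cell i y)
    define z where "z = flips (drop i ps) y"
    have z: "0 \<le> z" "z < u" using fl[OF cell] set_drop_subset[of i ps] by (auto simp: z_def)
    have Fx: "F (u * real i + y) = u * real i + z" using F[OF cell] by (simp add: z_def)
    have hx: "h (u * real i + y) = u * real (c i) + y" if "0 \<le> y" "y < u" for i y
      unfolding h_def by (rule cellmap_cell[OF that])
    have LHS: "(flips ps \<circ> D \<circ> h \<circ> F) (u * real i + y) = flips ps (D (u * real (c i) + z))"
      using Fx hx z by simp
    have RHS: "(F \<circ> h) (u * real i + y) = u * real (c i) + flips (drop (c i) ps) y"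
      using hx F cell by simp
    consider "i < N" | "i = N" | "i > N" by linarith
    then show ?case
    proof cases
      case 1
      have "drop i ps = ps ! i # drop (Suc i) ps" using 1 by (simp add: Cons_nth_drop_Suc N_def)
      then have "D (u * real (c i) + z) = u * real (c i) + flips (drop (c i) ps) y"
        using DS[OF 1 z] 1 by (simp add: c_def z_def)
      moreover have "u * real (c i) + flips (drop (c i) ps) y \<notin> {0..<u}"
      proof -
        have "0 \<le> flips (drop (c i) ps) y" using fl[OF cell] set_drop_subset[of "c i" ps] by blast
        moreover have "u * 1 \<le> u * real (c i)" using u(1) 1 by (intro mult_left_mono) (auto simp: c_def)
        ultimately show ?thesis by simp
      qed
      ultimately show ?thesis using LHS RHS fl_out by simp
    next
      case 2
      then have "z = y" "c i = 0" by (auto simp: z_def N_def c_def)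
      moreover have "y \<notin> \<Union> (Z ` {1..N})" using Zi[OF cell, of 0] Zdis by fastforce
      ultimately show ?thesis using LHS RHS D0[of y] by simp
    next
      case 3
      then have zc: "z = y" "c i = i" by (auto simp: z_def N_def c_def)
      have "u * real i + y \<notin> \<Union> (Z ` {1..N})" using Zi[OF cell, of i] Zdis 3 by fastforce
      moreover have "u * real i + y \<notin> {0..<u}"
      proof -
        have "u * 1 \<le> u * real i" using u(1) 3 by (intro mult_left_mono) auto
        then have "u \<le> u * real i + y" using cell by linarith
        then show ?thesis by simp
      qed
      ultimately show ?thesis using LHS RHS D0 fl_out zc 3 by (simp add: N_def)
    qed
  qed
  have "flips ps \<circ> D = commut F h"
    using FP hP eq by (intro commutI) (auto dest: PIsoD(1))
  then have "commut F h \<circ> D = flips ps \<circ> (D \<circ> D)" by (metis comp_assoc)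
  also have "D \<circ> D = id" unfolding D_def by (rule mflip_mflip[OF disD])
  finally have "flips ps = commut F h \<circ> D" by (simp only: comp_id)
  then show ?thesis using commut_Comms[OF FP hP] DC by blast
qed

section \<open>Elements of small support\<close>

lemma permutes_extend_inj:
  assumes "finite S" "X \<subseteq> S" "inj_on f X" "f ` X \<subseteq> S"
  shows "\<exists>p. p permutes S \<and> (\<forall>x\<in>X. p x = f x)"
proof -
  have fX: "finite X" using assms(1,2) finite_subset by blast
  have "card (S - X) = card (S - f ` X)"
    using assms fX by (simp add: card_Diff_subset card_image)
  then obtain b where b: "bij_betw b (S - X) (S - f ` X)"
    using finite_same_card_bij[of "S - X" "S - f ` X"] assms(1) by blast
  define p where "p x = (if x \<in> X then f x else if x \<in> S then b x else x)" for x
  have 1: "bij_betw p X (f ` X)"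
    using inj_on_imp_bij_betw[OF assms(3)] by (rule bij_betw_cong[THEN iffD1, rotated]) (simp add: p_def)
  have 2: "bij_betw p (S - X) (S - f ` X)"
    using b by (rule bij_betw_cong[THEN iffD1, rotated]) (simp add: p_def)
  have "bij_betw p (X \<union> (S - X)) (f ` X \<union> (S - f ` X))"
    using 1 2 by (rule bij_betw_combine) auto
  moreover have "X \<union> (S - X) = S" "f ` X \<union> (S - f ` X) = S" using assms by auto
  ultimately have "p permutes S" using assms(2) by (intro bij_imp_permutes) (auto simp: p_def)
  then show ?thesis by (auto simp: p_def)
qed

lemma card_breaks_comp:
  assumes "finite (breaks f)" "finite (breaks g)" "bij g"
  shows "finite (breaks (f \<circ> g))" "card (breaks (f \<circ> g)) \<le> card (breaks f) + card (breaks g)"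
proof -
  have fin: "finite (breaks g \<union> g -` breaks f)"
    using assms by (auto intro: finite_vimageI bij_is_inj)
  show "finite (breaks (f \<circ> g))" by (rule finite_subset[OF breaks_comp fin])
  have "card (breaks (f \<circ> g)) \<le> card (breaks g \<union> g -` breaks f)"
    by (rule card_mono[OF fin breaks_comp])
  also have "\<dots> \<le> card (breaks g) + card (g -` breaks f)" by (rule card_Un_le)
  also have "card (g -` breaks f) \<le> card (breaks f)"
    using assms by (intro card_vimage_inj_on_le[of g UNIV, simplified]) (auto intro: bij_is_inj)
  finally show "card (breaks (f \<circ> g)) \<le> card (breaks f) + card (breaks g)" by simp
qed

lemma card_breaks_inv:
  assumes "bij f" "finite (breaks f)"
  shows "card (breaks (inv f)) \<le> card (breaks f)"
  using assms by (simp add: breaks_inv card_image_le)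

lemma card_breaks_mflip: "finite (breaks (mflip n a b)) \<and> card (breaks (mflip n a b)) \<le> 2 * n"
proof (induction n)
  case 0 then show ?case by (simp add: mflip_def breaks_def)
next
  case (Suc n)
  have f: "finite (breaks (flip (a n) (b n)))" by (rule finite_subset[OF breaks_flip]) simp
  have "card (breaks (flip (a n) (b n))) \<le> card {a n, b n}" by (rule card_mono[OF _ breaks_flip]) simp
  also have "\<dots> \<le> 2" by (simp add: card_insert_if)
  finally have c: "card (breaks (flip (a n) (b n))) \<le> 2" .
  have eq: "mflip (Suc n) a b = mflip n a b \<circ> flip (a n) (b n)" by (simp only: mflip_def compose_upto.simps)
  have "card (breaks (mflip n a b \<circ> flip (a n) (b n))) \<le> 2 * n + 2"
    using card_breaks_comp(2)[OF conjunct1[OF Suc.IH] f bij_flip] conjunct2[OF Suc.IH] c by (meson add_mono order_trans)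
  then show ?case
    using card_breaks_comp(1)[OF conjunct1[OF Suc.IH] f bij_flip] unfolding eq mult_Suc_right add.commute[of 2] by (rule conjI[rotated])
qed

text \<open>Let \<open>q\<close> be the identity on a set \<open>W\<close> that contains all but at most \<open>M\<close> of the \<open>n\<close> open cells. A permutation of cells
conjugates \<open>q\<close>, up to finitely many points, into \<open>[0, M/n)\<close>, and the number of breaks of the conjugate there is bounded in terms of
\<open>M\<close>, the breaks of \<open>q\<close> and the grid points outside \<open>W\<close>. Hence the number of flips needed is bounded as
well, and they are two commutators if \<open>n\<close> is large enough.\<close>

lemma small_support_Comms:
  assumes q: "q \<in> PIso" and u: "u > 0" "u * real n = 1" and M: "M > 0"
    and W: "\<And>x. x \<in> W \<Longrightarrow> q x = x"
    and K: "card (breaks q) \<le> K"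
    and Y: "card {j. j < n \<and> \<not> {u * real j<..<u * real j + u} \<subseteq> W} \<le> M"
    and G: "card {j. j < n \<and> u * real j \<notin> W} \<le> G"
    and small: "M * (2 * (M + 1 + K + G) + 3) \<le> n"
  shows "\<exists>C\<in>Comms. \<exists>D\<in>Comms. q \<approx>\<^sub>f C \<circ> D"
proof -
  let ?Y = "{j. j < n \<and> \<not> {u * real j<..<u * real j + u} \<subseteq> W}"
  have "M * 1 \<le> M * (2 * (M + 1 + K + G) + 3)" by (rule mult_le_mono2) simp
  then have Mn: "M \<le> n" using small by linarith
  obtain f where f: "bij_betw f ?Y {0..<card ?Y}" using ex_bij_betw_finite_nat[of ?Y] by auto
  have "f ` ?Y \<subseteq> {..<M}" using f Y by (auto simp: bij_betw_def)
  then obtain c where c: "c permutes {..<n}" "\<forall>j\<in>?Y. c j = f j"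
    using permutes_extend_inj[of "{..<n}" ?Y f] bij_betw_imp_inj_on[OF f] Mn by fastforce
  have cY: "c j < M" if "j \<in> ?Y" for j using \<open>f ` ?Y \<subseteq> {..<M}\<close> c(2) that by auto
  have bc: "bij c" using c(1) by (rule permutes_bij)
  define H where "H = cellmap u c"
  have HP: "H \<in> PIso" unfolding H_def using u c by (intro cellmap_PIso[of u n]) auto
  have iH: "inv H = cellmap u (inv c)" unfolding H_def using u(1) bc by (rule inv_cellmap)
  define L where "L = u * real M"
  have L: "0 < L" "L \<le> 1"
  proof -
    show "0 < L" using u(1) M by (simp add: L_def)
    have "u * real M \<le> u * real n" using u(1) Mn by (intro mult_left_mono) auto
    then show "L \<le> 1" using u(2) by (simp add: L_def)
  qed
  define q' where "q' = H \<circ> q \<circ> inv H"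
  have q'P: "q' \<in> PIso" unfolding q'_def using HP q by (intro PIso_comp PIso_inv)
  have out: "q' x = x" if x: "x \<notin> {0..L}" "x \<notin> (\<lambda>j. u * real j) ` {..n}" for x
  proof (cases "x \<in> {0..<1}")
    case False then show ?thesis by (rule PIsoD(4)[OF q'P])
  next
    case True
    then obtain j y where jy: "x = u * real j + y" "0 \<le> y" "y < u"
      using cell_exists[OF u(1), of x] by auto
    have jn: "j < n"
    proof (rule ccontr)
      assume "\<not> j < n"
      then have "u * real n \<le> u * real j" using u(1) by (intro mult_left_mono) auto
      then show False using u(2) True jy by auto
    qed
    have "y \<noteq> 0" using x(2) jy(1) jn by auto
    have jM: "j \<ge> M"
    proof (rule ccontr)
      assume "\<not> j \<ge> M"
      then have "u * (real j + 1) \<le> u * real M" using u(1) by (intro mult_left_mono) auto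
      then show False using x(1) jy True by (auto simp: L_def algebra_simps)
    qed
    define i where "i = inv c j"
    have ci: "c i = j" using bc by (simp add: i_def bij_is_surj surj_f_inv_f)
    have "i < n" using permutes_in_image[OF c(1), of i] ci jn by simp
    moreover have "i \<notin> ?Y" using cY[of i] ci jM by auto
    ultimately have "{u * real i<..<u * real i + u} \<subseteq> W" by blast
    then have "u * real i + y \<in> W" using jy \<open>y \<noteq> 0\<close> by auto
    then have "q (u * real i + y) = u * real i + y" by (rule W)
    moreover have "inv H x = u * real i + y" unfolding iH jy(1) i_def using jy by (intro cellmap_cell)
    moreover have "H (u * real i + y) = x" unfolding H_def using cellmap_cell[OF jy(2,3), of c i] ci jy(1) by simp
    ultimately show ?thesis by (simp add: q'_def)
  qed
  have fin_out: "finite {x. x \<notin> {0..L} \<and> q' x \<noteq> x}"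
    by (rule finite_subset[of _ "(\<lambda>j. u * real j) ` {..n}"]) (use out in auto)
  let ?Gr = "(\<lambda>j. u * real j) ` {j. j < n \<and> u * real j \<notin> W}"
  let ?R = "(\<lambda>j. u * real j) ` {..M} \<union> H ` breaks q \<union> (\<lambda>z. H (inv q z)) ` ?Gr"
  have "breaks q' \<inter> {0<..<L} \<subseteq> ?R"
  proof (rule subsetI, rule ccontr)
    fix x assume "x \<in> breaks q' \<inter> {0<..<L}" and nR: "x \<notin> ?R"
    then have x: "x \<in> breaks q'" "0 < x" "x < L" by auto
    define x0 where "x0 = inv H x"
    have Hx0: "H x0 = x" using PIsoD(3)[OF HP] by (simp add: x0_def surj_f_inv_f)
    have ng: "x \<noteq> u * real j" for j
    proof
      assume j: "x = u * real j"
      then have "u * real j < u * real M" using x(3) by (simp add: L_def)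
      then have "j \<le> M" using u(1) by simp
      then show False using nR j by blast
    qed
    have 1: "isometric_at (inv H) x" unfolding iH using u(1) ng by (rule isometric_at_cellmap_inner)
    have "x0 \<notin> breaks q" using nR Hx0 by blast
    then have 2: "isometric_at q x0" by (simp add: breaks_def)
    \<comment> \<open>\<open>H\<close> can break at \<open>q x0\<close> only if this is a grid point. A grid point in \<open>W\<close> is fixed by \<open>q\<close>, so that
\<open>x0\<close> and then \<open>x\<close> would be grid points too; those outside \<open>W\<close> are counted by \<open>G\<close>.\<close>
    have 3: "isometric_at H (q x0)"
    proof (cases "\<exists>j. q x0 = u * real j")
      case False then show ?thesis unfolding H_def using u(1) by (intro isometric_at_cellmap_inner) auto
    next
      case True
      then obtain j where j: "q x0 = u * real j" by blast
      have "x0 \<in> {0..<1}" using PIso_mem_iff[OF HP, of x0] Hx0 x(2,3) L by auto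
      then have "q x0 \<in> {0..<1}" using PIso_mem_iff[OF q] by blast
      then have "u * real j < u * real n" using j u(2) by auto
      then have jn: "j < n" using u(1) by simp
      show ?thesis
      proof (cases "u * real j \<in> W")
        case True
        then have "q (q x0) = q x0" using W j by simp
        then have "x0 = u * real j" using PIsoD(2)[OF q] j by (metis injD)
        then have "x = u * real (c j)" using Hx0 u(1) by (simp add: H_def cellmap_grid)
        then show ?thesis using ng by blast
      next
        case False
        have "H (inv q (u * real j)) = x" using j PIsoD(2)[OF q] Hx0 by (metis inv_f_f)
        then have "x \<in> ?R" using False jn by blast
        then show ?thesis using nR by blast
      qed
    qed
    have "isometric_at q' x" unfolding q'_def
      by (intro isometric_at_comp) (use 1 2 3 in \<open>simp_all add: x0_def\<close>)
    then show False using x(1) by (simp add: breaks_def)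
  qed
  moreover have finR: "finite ?R" using PIsoD(5)[OF q] by auto
  ultimately have "card (breaks q' \<inter> {0<..<L}) \<le> card ?R" by (intro card_mono)
  also have "\<dots> \<le> card ((\<lambda>j. u * real j) ` {..M}) + card (H ` breaks q) + card ((\<lambda>z. H (inv q z)) ` ?Gr)"
    by (meson add_le_mono1 card_Un_le order_trans)
  also have "\<dots> \<le> (M + 1) + K + G"
  proof (intro add_mono)
    show "card ((\<lambda>j. u * real j) ` {..M}) \<le> M + 1" using card_image_le[of "{..M}"] by simp
    show "card (H ` breaks q) \<le> K" using card_image_le[OF PIsoD(5)[OF q]] K by (rule order_trans)
    show "card ((\<lambda>z. H (inv q z)) ` ?Gr) \<le> G"
      unfolding image_image by (rule order_trans[OF card_image_le G]) simp
  qed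
  finally have cb: "card (breaks q' \<inter> {0<..<L}) \<le> M + 1 + K + G" .
  obtain ps where ps: "length ps \<le> 2 * card (breaks q' \<inter> {0<..<L}) + 2"
      "\<forall>p\<in>set ps. 0 \<le> fst p \<and> snd p \<le> L" "q' \<approx>\<^sub>f flips ps"
    using sort_by_flips[OF PIsoD(1,5)[OF q'P] L(1) fin_out] by blast
  have "2 * card (breaks q' \<inter> {0<..<L}) \<le> 2 * (M + 1 + K + G)" using cb by (rule mult_le_mono2)
  with ps(1) have "length ps \<le> 2 * (M + 1 + K + G) + 2" by (meson add_le_mono1 order_trans)
  then have "length ps + 1 \<le> 2 * (M + 1 + K + G) + 3" by simp
  then have "M * (length ps + 1) \<le> M * (2 * (M + 1 + K + G) + 3)" by (rule mult_le_mono2)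
  then have "M * (length ps + 1) \<le> n" using small by linarith
  then have "real (M * (length ps + 1)) \<le> real n" by linarith
  then have "u * real (M * (length ps + 1)) \<le> u * real n" using u(1) by (intro mult_left_mono) auto
  then have "L * (real (length ps) + 1) \<le> 1" using u(2) by (simp add: L_def algebra_simps)
  then obtain C D where CD: "C \<in> Comms" "D \<in> Comms" "flips ps = C \<circ> D"
    using flips_two_commut[OF L(1), of ps] ps(2) by blast
  have HH: "H \<circ> inv H = id" "inv H \<circ> H = id"
    using PIsoD(2,3)[OF HP] by (simp_all add: surj_iff)
  have ih: "inv H \<in> PIso" "inv (inv H) = H" using HP PIsoD(1)[OF HP] by (auto simp: inv_inv_eq)
  have "inv H \<circ> q' \<circ> H = (inv H \<circ> H) \<circ> q \<circ> (inv H \<circ> H)" unfolding q'_def by (simp only: comp_assoc)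
  then have conj_q: "q = inv H \<circ> q' \<circ> H" using HH by simp
  have "inv H \<circ> q' \<circ> H \<approx>\<^sub>f inv H \<circ> (C \<circ> D) \<circ> H"
    using ps(3) CD PIsoD(2)[OF HP] PIsoD(2)[OF PIso_comp[OF Comms_PIso Comms_PIso], OF CD(1,2)]
    by (intro fin_eq_comp) auto
  also have "inv H \<circ> (C \<circ> D) \<circ> H = inv H \<circ> C \<circ> (H \<circ> inv H) \<circ> D \<circ> H"
    unfolding HH by (simp add: comp_assoc)
  also have "\<dots> = (inv H \<circ> C \<circ> inv (inv H)) \<circ> (inv H \<circ> D \<circ> inv (inv H))"
    unfolding ih(2) by (simp only: comp_assoc)
  finally show ?thesis unfolding conj_q[symmetric] using Comms_conj[OF CD(1) ih(1)] Comms_conj[OF CD(2) ih(1)] by blast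
qed

section \<open>Approximation by a permutation of cells\<close>

text \<open>If each interval of a subdivision of \<open>[0, 1]\<close> accounts for all but \<open>d\<close> of its share of \<open>n\<close> grid indices,
then at most \<open>d m\<close> of \<open>n\<close> indices are not accounted for, however fine the grid.\<close>

lemma card_uncovered:
  fixes lam :: "nat \<Rightarrow> real"
  assumes T: "\<And>k. k < m \<Longrightarrow> T k \<subseteq> {..<N}" "disjoint_family_on T {..<m}"
    and card: "\<And>k. k < m \<Longrightarrow> real (card (T k)) \<ge> real n * lam k - d" and lam: "(\<Sum>k<m. lam k) = 1"
  shows "real (card ({..<N} - (\<Union>k<m. T k))) \<le> real N - real n + d * real m"
proof -
  have fT: "finite (T k)" if "k < m" for k using T(1)[OF that] by (rule finite_subset) simp
  have sub: "(\<Union>k<m. T k) \<subseteq> {..<N}" using T(1) by blast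
  have "real n - d * real m = (\<Sum>k<m. real n * lam k - d)"
    by (simp add: sum_subtractf lam flip: sum_distrib_left)
  also have "\<dots> \<le> (\<Sum>k<m. real (card (T k)))" by (rule sum_mono) (use card in auto)
  also have "\<dots> = real (card (\<Union>k<m. T k))"
    using fT T(2) by (subst card_UN_disjoint) (auto simp: disjoint_family_on_def)
  finally have "real n - d * real m \<le> real (card (\<Union>k<m. T k))" .
  moreover have "card ({..<N} - (\<Union>k<m. T k)) = N - card (\<Union>k<m. T k)"
    using sub by (subst card_Diff_subset) (auto intro: finite_subset)
  moreover have "card (\<Union>k<m. T k) \<le> N" using card_mono[OF _ sub] by simp
  ultimately show ?thesis by linarith
qed

lemma grid_ceiling:
  assumes u: "u > 0" "u * real n = 1" and z: "z \<ge> 0"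
  shows "z \<le> u * real (nat \<lceil>real n * z\<rceil>)" "u * real (nat \<lceil>real n * z\<rceil>) < z + u"
proof -
  have n: "real n = 1 / u" using u by (simp add: field_simps)
  have "real (nat \<lceil>real n * z\<rceil>) = of_int \<lceil>real n * z\<rceil>" using z by simp
  moreover have "real n * z \<le> of_int \<lceil>real n * z\<rceil>" "of_int \<lceil>real n * z\<rceil> < real n * z + 1" by linarith+
  ultimately have "z / u \<le> real (nat \<lceil>real n * z\<rceil>)" "real (nat \<lceil>real n * z\<rceil>) < z / u + 1"
    by (simp_all add: n)
  then show "z \<le> u * real (nat \<lceil>real n * z\<rceil>)" "u * real (nat \<lceil>real n * z\<rceil>) < z + u"
    using u(1) by (simp_all add: field_simps)
qed

lemma subdivision_mono:
  fixes a :: "nat \<Rightarrow> real"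
  assumes "\<And>k. k < m \<Longrightarrow> a k < a (Suc k)" "i \<le> j" "j \<le> m" shows "a i \<le> a j"
  using assms(2,3)
proof (induction j rule: dec_induct)
  case (step j)
  then show ?case using assms(1)[of j] by simp
qed simp

lemma subdivision_piece_unique:
  fixes a :: "nat \<Rightarrow> real"
  assumes a: "\<And>k. k < m \<Longrightarrow> a k < a (Suc k)"
    and kl: "k < m" "l < m" "a k < x" "x < a (Suc k)" "a l < x" "x < a (Suc l)"
  shows "k = l"
proof (rule ccontr)
  assume "k \<noteq> l"
  then consider "Suc k \<le> l" | "Suc l \<le> k" by linarith
  then show False
    using kl subdivision_mono[of m a "Suc k" l, OF a] subdivision_mono[of m a "Suc l" k, OF a]
    by cases auto
qed

lemma breaks_piecewise:
  assumes a: "a 0 = 0" "a m = 1" and out: "\<And>x. x \<notin> {0..<1} \<Longrightarrow> g x = x"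
    and piece: "\<And>k. k < m \<Longrightarrow> \<exists>s c. (s = 1 \<or> s = -1) \<and> (\<forall>x\<in>{a k<..<a (Suc k)}. g x = s * x + c)"
  shows "breaks g \<subseteq> a ` {..m}"
proof (rule subsetI, rule ccontr)
  fix x assume x: "x \<in> breaks g" "x \<notin> a ` {..m}"
  have n01: "x \<noteq> 0" "x \<noteq> 1"
    using x(2) a by (metis atMost_iff image_eqI le0, metis atMost_iff image_eqI order_refl)
  have "isometric_at g x"
  proof (cases "0 < x \<and> x < 1")
    case True
    define k where "k = (LEAST k. x < a k)"
    have "x < a m" using True a by simp
    then have k: "x < a k" "k \<le> m" unfolding k_def by (rule LeastI, rule Least_le)
    then obtain k' where k': "k = Suc k'" using a(1) True by (cases k) auto
    then have "\<not> x < a k'" using not_less_Least[of k' "\<lambda>k. x < a k"] by (simp add: k_def)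
    moreover have "x \<noteq> a k'" using x(2) k k' by auto
    ultimately have xk: "x \<in> {a k'<..<a (Suc k')}" using k k' by auto
    have "k' < m" using k k' by simp
    from piece[OF this] obtain s c
      where "s = 1 \<or> s = -1" "\<forall>x\<in>{a k'<..<a (Suc k')}. g x = s * x + c" by blast
    then show ?thesis using xk by (intro isometric_at_affineI[OF open_greaterThanLessThan]) blast+
  next
    case False
    then have "x \<in> - {0..1}" using n01 by auto
    then show ?thesis by (intro isometric_at_affineI[of "- {0..1}" x 1 _ 0]) (auto simp: out)
  qed
  then show False using x(1) by (simp add: breaks_def)
qed

text \<open>An exchange \<open>g\<close> reversing the orientation of each of its \<open>m\<close> pieces is a product of four commutators. On a
grid of mesh \<open>u = 1/n\<close>, let \<open>P\<close> permute cells so that a block of cells inside the \<open>k\<close>-th piece, filling it up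
to an error of order \<open>u\<close>, goes to a block of cells inside its image. Inside the \<open>k\<close>-th piece, \<open>P\<inverse> g\<close>
reverses an interval \<open>I k\<close> onto that block; so does the flip of an interval \<open>(l k, r k)\<close> of the piece. With \<open>R\<close> the
simultaneous flip of these, \<open>q = R P\<inverse> g\<close> is the identity on every \<open>I k\<close>. Since the number of breaks of \<open>q\<close>
and of cells not contained in some \<open>I k\<close> is bounded in terms of \<open>m\<close> alone, \<open>q\<close> is a product of two commutators
when \<open>n\<close> is chosen large.\<close>

lemma reversing_exchange_Comms:
  assumes g: "g \<in> PIso" and a: "a 0 = 0" "a m = 1" "\<And>k. k < m \<Longrightarrow> a k < a (Suc k)"
    and rev: "\<And>k x. k < m \<Longrightarrow> a k < x \<Longrightarrow> x < a (Suc k) \<Longrightarrow> g x = e k - x"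
  shows "\<exists>P\<in>Comms. \<exists>R\<in>Comms. \<exists>C\<in>Comms. \<exists>D\<in>Comms. g \<approx>\<^sub>f P \<circ> R \<circ> C \<circ> D"
proof -
  have m0: "m > 0" using a(1,2) by (cases m) auto
  have a_mono: "a i \<le> a j" if "i \<le> j" "j \<le> m" for i j
    using subdivision_mono[of m a i j] a(3) that by blast
  have a01: "0 \<le> a k" "a k \<le> 1" if "k \<le> m" for k
    using a_mono[of 0 k] a_mono[of k m] that a by auto
  have same: "k = l" if "k < m" "l < m" "a k < x" "x < a (Suc k)" "a l < x" "x < a (Suc l)" for k l x
    using subdivision_piece_unique[of m a k l x] a(3) that by blast
  have pieces_disjoint: "disjoint_family_on I {..<m}" 
    if "\<And>k x. k < m \<Longrightarrow> x \<in> I k \<Longrightarrow> a k < h x \<and> h x < a (Suc k)" for I :: "nat \<Rightarrow> 'z set" and h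
    unfolding disjoint_family_on_def using that same by (metis disjoint_iff lessThan_iff)
  define lam where "lam k = a (Suc k) - a k" for k
  have lam: "(\<Sum>k<m. lam k) = 1" unfolding lam_def by (subst sum_lessThan_telescope) (simp add: a)
  have g01: "0 \<le> e k - x" "e k - x \<le> 1" if "k < m" "a k < x" "x < a (Suc k)" for k x
  proof -
    have "x \<in> {0..<1}" using that a01[of k] a01[of "Suc k"] by auto
    then have "g x \<in> {0..<1}" using PIso_mem_iff[OF g] by blast
    then show "0 \<le> e k - x" "e k - x \<le> 1" using rev[OF that] by auto
  qed
  \<comment> \<open>The image of the \<open>k\<close>-th piece is the interval \<open>(y k, y k + lam k)\<close>.\<close>
  define y where "y k = e k - a (Suc k)" for k
  have y0: "0 \<le> y k" if k: "k < m" for k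
  proof -
    have "a (Suc k) \<le> e k" using g01(1)[OF k] by (intro dense_le_bounded[OF a(3)[OF k]]) auto
    then show ?thesis by (simp add: y_def)
  qed
  have y1: "y k + lam k \<le> 1" if k: "k < m" for k
  proof -
    have "e k - 1 \<le> a k" using g01(2)[OF k] by (intro dense_ge_bounded[OF a(3)[OF k]]) (auto simp: algebra_simps)
    then show ?thesis by (simp add: y_def lam_def)
  qed
  \<comment> \<open>Bounds for the bad cells, the breaks of \<open>q\<close> and the bad grid points; they depend on \<open>m\<close> only, so that
\<open>n\<close> can be chosen after them.\<close>
  define M K G where "M = 3 * m" and "K = (m + 1) + (3 * m + 1) + 2 * m" and "G = 4 * m"
  define n where "n = M * (2 * (M + 1 + K + G) + 3)"
  have n0: "n > 0" using m0 by (simp add: n_def M_def)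
  define u where "u = 1 / real n"
  have u: "u > 0" "u * real n = 1" using n0 by (simp_all add: u_def)
  define A where "A k = nat \<lceil>real n * a k\<rceil>" for k
  define C where "C k = nat \<lceil>real n * y k\<rceil>" for k
  \<comment> \<open>Truncated at \<open>0\<close>: pieces shorter than \<open>2 u\<close> get an empty block.\<close>
  define N where "N k = nat (\<lfloor>real n * lam k\<rfloor> - 1)" for k
  have N: "real (N k) \<ge> real n * lam k - 2" "N k > 0 \<Longrightarrow> u * real (N k) + u \<le> lam k" for k
  proof -
    show "real (N k) \<ge> real n * lam k - 2" unfolding N_def by linarith
    assume "N k > 0"
    then have "real (N k) + 1 \<le> real n * lam k" unfolding N_def by linarith
    then have "u * (real (N k) + 1) \<le> u * (real n * lam k)" using u(1) by (intro mult_left_mono) auto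
    also have "\<dots> = lam k" using u(2) by (simp flip: mult.assoc)
    finally show "u * real (N k) + u \<le> lam k" by (simp add: algebra_simps)
  qed
  have A: "a k \<le> u * real (A k)" "u * real (A k) < a k + u" if "k < m" for k
    unfolding A_def using grid_ceiling[OF u a01(1)] that by simp_all
  have C: "y k \<le> u * real (C k)" "u * real (C k) < y k + u" if "k < m" for k
    unfolding C_def using grid_ceiling[OF u y0[OF that]] by simp_all
  have le_n: "j < n" if "u * real j + u \<le> 1" for j
  proof -
    have "u * (real j + 1) \<le> u * real n" using that u(2) by (simp add: algebra_simps)
    then show ?thesis using u(1) by simp
  qed
  have idx: "u * real (b + i) + u \<le> u * real b + u * real l" if "i < l" for b i l
  proof -
    have "u * (real (b + i) + 1) \<le> u * (real b + real l)" using that u(1) by (intro mult_left_mono) auto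
    then show ?thesis by (simp add: algebra_simps)
  qed
  define X where "X k = {A k..<A k + N k}" for k
  have X: "a k \<le> u * real j \<and> u * real j + u \<le> a (Suc k)" if kj: "k < m" "j \<in> X k" for k j
  proof -
    obtain i where i: "j = A k + i" "i < N k" using kj(2) by (auto simp: X_def nat_le_iff_add)
    have "u * real (A k) \<le> u * real j" using u(1) i by simp
    moreover have "N k > 0" "u * real j + u \<le> u * real (A k) + u * real (N k)"
      using idx[OF i(2), of "A k"] i by auto
    ultimately show ?thesis using A[OF kj(1)] N(2)[of k] unfolding lam_def by linarith
  qed
  have Xn: "X k \<subseteq> {..<n}" if "k < m" for k
    using X[OF that] a01(2)[of "Suc k"] that by (auto intro!: le_n intro: order_trans)
  have Xdis: "disjoint_family_on X {..<m}"
  proof (rule pieces_disjoint[of _ "\<lambda>j. u * real j + u / 2"])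
    fix k j assume "k < m" "j \<in> X k"
    then have "a k \<le> u * real j" "u * real j + u \<le> a (Suc k)" using X by auto
    then show "a k < u * real j + u / 2 \<and> u * real j + u / 2 < a (Suc k)" using u(1) by linarith
  qed
  have Cblock: "y k \<le> u * real j \<and> u * real j + u \<le> y k + lam k" 
    if kj: "k < m" "j \<in> {C k..<C k + N k}" for k j
  proof -
    obtain i where i: "j = C k + i" "i < N k" using kj(2) by (auto simp: nat_le_iff_add)
    have "u * real (C k) \<le> u * real j" using u(1) i by simp
    moreover have "N k > 0" "u * real j + u \<le> u * real (C k) + u * real (N k)"
      using idx[OF i(2), of "C k"] i by auto
    ultimately show ?thesis using C[OF kj(1)] N(2)[of k] by linarith
  qed
  have Cdis: "k = l" if kl: "k < m" "l < m" "j \<in> {C k..<C k + N k}" "j \<in> {C l..<C l + N l}" for k l j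
  proof -
    define z where "z = u * real j + u / 2"
    have z: "y k < z" "z < y k + lam k" "y l < z" "z < y l + lam l"
      using Cblock[OF kl(1,3)] Cblock[OF kl(2,4)] u(1) by (auto simp: z_def)
    have k: "a k < e k - z" "e k - z < a (Suc k)" and l: "a l < e l - z" "e l - z < a (Suc l)"
      using z by (auto simp: y_def lam_def)
    have "g (e k - z) = g (e l - z)" using rev[OF kl(1) k] rev[OF kl(2) l] by simp
    then have "e k - z = e l - z" by (rule injD[OF PIsoD(2)[OF g]])
    then show ?thesis using same[OF kl(1,2) k] l by simp
  qed
  define bl where "bl j = (THE k. k < m \<and> j \<in> X k)" for j
  have bl: "bl j = k" if "k < m" "j \<in> X k" for j k
    unfolding bl_def using that Xdis by (intro the_equality) (auto simp: disjoint_family_on_def)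
  define f where "f j = C (bl j) + (j - A (bl j))" for j
  have fX: "f j \<in> {C k..<C k + N k}" "j = A k + (f j - C k)" if "k < m" "j \<in> X k" for j k
    using bl[OF that] that(2) by (auto simp: f_def X_def)
  have injf: "inj_on f (\<Union>k<m. X k)"
  proof (rule inj_onI)
    fix i j assume "i \<in> (\<Union>k<m. X k)" "j \<in> (\<Union>k<m. X k)" and eq: "f i = f j"
    then obtain k l where kl: "k < m" "i \<in> X k" "l < m" "j \<in> X l" by auto
    have "k = l" using Cdis[OF kl(1,3), of "f i"] fX(1)[OF kl(1,2)] fX(1)[OF kl(3,4)] eq by simp
    then show "i = j" using fX(2)[OF kl(1,2)] fX(2)[OF kl(3,4)] eq by simp
  qed
  have fim: "f ` (\<Union>k<m. X k) \<subseteq> {..<n}"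
  proof safe
    fix k j assume "k < m" "j \<in> X k"
    then have "u * real (f j) + u \<le> 1" using Cblock[OF _ fX(1)] y1 by force
    then show "f j < n" by (rule le_n)
  qed
  obtain p where p: "p permutes {..<n}" "\<forall>j\<in>(\<Union>k<m. X k). p j = f j"
    using permutes_extend_inj[OF _ _ injf fim] Xn by blast
  have pA: "p (A k + i) = C k + i" if "k < m" "i < N k" for k i
  proof -
    have "A k + i \<in> X k" using that by (simp add: X_def)
    then show ?thesis using p(2) that(1) bl[of k "A k + i"] by (auto simp: f_def)
  qed
  define P where "P = cellmap u p"
  have PC: "P \<in> Comms" unfolding P_def using u p(1) by (intro cellmap_Comms[of u n]) auto
  \<comment> \<open>\<open>g\<close> maps the interval of length \<open>u N k\<close> starting at \<open>b k\<close> onto the block of cells inside the image.\<close>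
  define b where "b k = e k - u * real (C k) - u * real (N k)" for k
  have b: "a k \<le> b k" "b k + u * real (N k) \<le> a (Suc k)" if "k < m" "N k > 0" for k
    using C[OF that(1)] N(2)[OF that(2)] by (auto simp: b_def y_def lam_def)
  have Alast: "u * real (A k) + u * real (N k) \<le> a (Suc k)" if "k < m" "N k > 0" for k
    using A[OF that(1)] N(2)[OF that(2)] by (auto simp: lam_def)
  \<comment> \<open>The flip of the smallest interval containing two intervals of equal length exchanges them.\<close>
  define l where "l k = (if N k = 0 then a k else min (u * real (A k)) (b k))" for k
  define r where "r k = (if N k = 0 then a k else max (u * real (A k)) (b k) + u * real (N k))" for k
  have lr: "a k \<le> l k" "r k \<le> a (Suc k)" if "k < m" for k
    using A[OF that] b[OF that] Alast[OF that] a(3)[OF that] by (auto simp: l_def r_def max_def)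
  define R where "R = mflip m l r"
  have disR: "disjoint_family_on (\<lambda>k. {l k<..<r k}) {..<m}"
    using lr by (intro pieces_disjoint[of _ "\<lambda>x. x"]) force
  have RC: "R \<in> Comms"
    unfolding R_def
  proof (rule mflip_Comms[OF _ disR])
    fix k assume "k < m"
    then show "0 \<le> l k \<and> r k \<le> 1" using lr[of k] a01(1)[of k] a01(2)[of "Suc k"] by auto
  qed
  have RR: "R \<circ> R = id" unfolding R_def by (rule mflip_mflip[OF disR])
  define I where "I k = {b k<..<b k + u * real (N k)}" for k
  have I_a: "a k < x \<and> x < a (Suc k)" if "k < m" "x \<in> I k" for k x
  proof -
    have "N k > 0" using that(2) by (cases "N k") (auto simp: I_def)
    then show ?thesis using b[OF that(1)] that(2) by (auto simp: I_def)
  qed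
  have key: "P (R x) = g x" if k: "k < m" and x: "x \<in> I k" for k x
  proof -
    have Nk: "N k > 0" using x by (cases "N k") (auto simp: I_def)
    have "x \<in> {l k<..<r k}" using x Nk by (auto simp: l_def r_def I_def)
    then have Rx: "R x = l k + r k - x" unfolding R_def by (rule mflip_at[OF disR k])
    define z where "z = b k + u * real (N k) - x"
    have z: "0 < z" "z < u * real (N k)" using x by (auto simp: z_def I_def)
    obtain i w where iw: "z = u * real i + w" "0 \<le> w" "w < u"
      using cell_exists[OF u(1), of z] z(1) by auto
    have "u * real i < u * real (N k)" using iw z by linarith
    then have i: "i < N k" using u(1) by simp
    have "l k + r k = u * real (A k) + b k + u * real (N k)" using Nk by (auto simp: l_def r_def)
    then have "R x = u * real (A k) + z" unfolding Rx z_def by linarith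
    then have "R x = u * real (A k + i) + w" unfolding iw(1) by (simp add: algebra_simps)
    then have "P (R x) = u * real (C k + i) + w" 
      unfolding P_def pA[OF k i, symmetric] by (simp only: cellmap_cell[OF iw(2,3)])
    also have "\<dots> = e k - x" using iw by (simp add: z_def b_def algebra_simps)
    finally show ?thesis using rev[OF k] I_a[OF k x] by simp
  qed
  define q where "q = R \<circ> inv P \<circ> g"
  have PP: "P \<in> PIso" "R \<in> PIso" using PC RC by (auto intro: Comms_PIso)
  have qP: "q \<in> PIso" unfolding q_def using PP g by (intro PIso_comp PIso_inv)
  have gq: "g = P \<circ> R \<circ> q"
  proof -
    have "P \<circ> R \<circ> q = P \<circ> (R \<circ> R) \<circ> inv P \<circ> g" unfolding q_def by (simp only: comp_assoc)
    also have "\<dots> = P \<circ> inv P \<circ> g" unfolding RR by (simp only: comp_id)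
    also have "P \<circ> inv P = id" using PIsoD(3)[OF PP(1)] by (simp add: surj_iff)
    finally show ?thesis by (simp only: id_comp)
  qed
  define W where "W = (\<Union>k<m. I k)"
  have qW: "q x = x" if kj: "x \<in> W" for x
  proof -
    obtain k where "k < m" "x \<in> I k" using kj by (auto simp: W_def)
    then have "q x = R (inv P (P (R x)))" using key by (simp add: q_def)
    also have "\<dots> = R (R x)" using PIsoD(2)[OF PP(1)] by simp
    also have "\<dots> = x" using RR by (metis comp_apply id_apply)
    finally show ?thesis .
  qed
  have "card (breaks q) \<le> K"
  proof -
    have "\<exists>s c. (s = 1 \<or> s = -1) \<and> (\<forall>x\<in>{a k<..<a (Suc k)}. g x = s * x + c)" if "k < m" for k
      using rev[OF that] by (intro exI[of _ "-1"] exI[of _ "e k"]) auto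
    then have "breaks g \<subseteq> a ` {..m}" by (intro breaks_piecewise a PIsoD(4)[OF g])
    then have bg: "card (breaks g) \<le> m + 1"
      using card_mono[of "a ` {..m}" "breaks g"] card_image_le[of "{..m}" a] by simp
    have bP: "card (breaks P) \<le> 3 * m + 1"
    proof -
      define T where "T k = {A k + 1..<A k + N k}" for k
      have "real (card ({..<n + 1} - (\<Union>k<m. T k))) \<le> real (n + 1) - real n + 3 * real m"
      proof (rule card_uncovered[OF _ _ _ lam])
        fix k assume "k < m"
        have "T k \<subseteq> X k" by (auto simp: T_def X_def)
        then show "T k \<subseteq> {..<n + 1}" using Xn[OF \<open>k < m\<close>] by force
        show "real n * lam k - 3 \<le> real (card (T k))" using N(1)[of k] by (simp add: T_def)
      next
        show "disjoint_family_on T {..<m}"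
          using Xdis by (rule disjoint_family_on_bisimulation) (auto simp: T_def X_def)
      qed
      moreover have "breaks P \<subseteq> (\<lambda>j. u * real j) ` ({..<n + 1} - (\<Union>k<m. T k))"
      proof -
        have "j \<notin> T k" if "k < m" "\<forall>i. j = Suc i \<longrightarrow> p j \<noteq> Suc (p i)" for j k
        proof
          assume "j \<in> T k"
          then obtain i where "j = Suc (A k + i)" "Suc i < N k" by (auto simp: T_def nat_le_iff_add)
          then show False using pA[OF \<open>k < m\<close>, of i] pA[OF \<open>k < m\<close>, of "Suc i"] that(2) by auto
        qed
        then have "{j. j \<le> n \<and> (\<forall>i. j = Suc i \<longrightarrow> p j \<noteq> Suc (p i))} \<subseteq> {..<n + 1} - (\<Union>k<m. T k)"
          by auto
        then show ?thesis unfolding P_def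
          by (intro order_trans[OF breaks_cellmap[OF u(1) p(1)]] image_mono)
      qed
      then have "card (breaks P) \<le> card ({..<n + 1} - (\<Union>k<m. T k))" by (intro surj_card_le) auto
      ultimately show ?thesis by simp
    qed
    have bR: "card (breaks R) \<le> 2 * m" unfolding R_def using card_breaks_mflip by blast
    have b: "bij f" and fb: "finite (breaks f)" if "f \<in> PIso" for f
      using PIsoD(1,5)[OF that] by auto
    have iP: "inv P \<in> PIso" and iPg: "inv P \<circ> g \<in> PIso" using PP g by auto
    have "card (breaks q) \<le> card (breaks R) + card (breaks (inv P \<circ> g))"
      unfolding q_def comp_assoc by (intro card_breaks_comp b fb PP iPg)
    also have "card (breaks (inv P \<circ> g)) \<le> card (breaks (inv P)) + card (breaks g)"
      by (intro card_breaks_comp b fb iP g)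
    also have "card (breaks (inv P)) \<le> card (breaks P)" by (intro card_breaks_inv b fb PP)
    finally show ?thesis using bg bP bR by (simp add: K_def)
  qed
  moreover define B where "B k = nat \<lceil>real n * b k\<rceil>" for k
  have B: "b k \<le> u * real (B k)" "u * real (B k) < b k + u" if "k < m" "N k > 0" for k
    unfolding B_def using grid_ceiling[OF u order_trans[OF a01(1) b(1)[OF that]]] that by simp_all
  have Bcell: "b k \<le> u * real j \<and> u * real j + u < b k + u * real (N k)"
    if kj: "k < m" "j \<in> {B k..<B k + N k - 1}" for k j
  proof -
    obtain i where i: "j = B k + i" "i < N k - 1" using kj(2) by (auto simp: nat_le_iff_add)
    have Nk: "N k > 0" using i by auto
    have "u * real (N k - 1) = u * real (N k) - u" using Nk by (simp add: of_nat_diff algebra_simps)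
    moreover have "u * real (B k) \<le> u * real j" using u(1) i by simp
    moreover have "u * real j + u \<le> u * real (B k) + u * real (N k - 1)"
      using idx[OF i(2), of "B k"] i by auto
    ultimately show ?thesis using B[OF kj(1) Nk] by linarith
  qed
  have mid: "u * real j + u / 2 \<in> I k" if "k < m" "j \<in> {B k..<B k + N k - 1}" for k j
    using Bcell[OF that] u(1) by (auto simp: I_def)
  have Bdis: "disjoint_family_on T {..<m}" if "\<And>k. k < m \<Longrightarrow> T k \<subseteq> {B k..<B k + N k - 1}" for T
    by (rule pieces_disjoint[of _ "\<lambda>j. u * real j + u / 2"]) (use that mid I_a in blast)
  have Bn: "{B k..<B k + N k - 1} \<subseteq> {..<n}" if "k < m" for k
  proof
    fix j assume j: "j \<in> {B k..<B k + N k - 1}"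
    then have "N k > 0" by auto
    then have "u * real j + u \<le> 1"
      using Bcell[OF that j] b(2)[OF that] a01(2)[of "Suc k"] that by simp
    then show "j \<in> {..<n}" using le_n by simp
  qed
  have "card {j. j < n \<and> \<not> {u * real j<..<u * real j + u} \<subseteq> W} \<le> M"
  proof -
    define T where "T k = {B k..<B k + N k - 1}" for k
    have "real (card ({..<n} - (\<Union>k<m. T k))) \<le> real n - real n + 3 * real m"
    proof (rule card_uncovered[OF _ _ _ lam])
      fix k assume "k < m"
      show "T k \<subseteq> {..<n}" using Bn[OF \<open>k < m\<close>] by (simp add: T_def)
      show "real n * lam k - 3 \<le> real (card (T k))" using N(1)[of k] by (simp add: T_def)
    qed (auto intro!: Bdis simp: T_def)
    moreover have "{j. j < n \<and> \<not> {u * real j<..<u * real j + u} \<subseteq> W} \<subseteq> {..<n} - (\<Union>k<m. T k)"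
    proof -
      have "{u * real j<..<u * real j + u} \<subseteq> W" if "k < m" "j \<in> T k" for j k
        using Bcell[OF that(1), of j] that unfolding W_def T_def I_def by fastforce
      then show ?thesis by auto
    qed
    then have "card {j. j < n \<and> \<not> {u * real j<..<u * real j + u} \<subseteq> W} \<le> card ({..<n} - (\<Union>k<m. T k))"
      by (intro card_mono) auto
    ultimately show ?thesis by (simp add: M_def)
  qed
  moreover have "card {j. j < n \<and> u * real j \<notin> W} \<le> G"
  proof -
    define T where "T k = {B k + 1..<B k + N k - 1}" for k
    have "real (card ({..<n} - (\<Union>k<m. T k))) \<le> real n - real n + 4 * real m"
    proof (rule card_uncovered[OF _ _ _ lam])
      fix k assume "k < m"
      have "T k \<subseteq> {B k..<B k + N k - 1}" by (auto simp: T_def)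
      then show "T k \<subseteq> {..<n}" using Bn[OF \<open>k < m\<close>] by blast
      show "real n * lam k - 4 \<le> real (card (T k))" using N(1)[of k] by (simp add: T_def)
    qed (auto intro!: Bdis simp: T_def)
    moreover have "{j. j < n \<and> u * real j \<notin> W} \<subseteq> {..<n} - (\<Union>k<m. T k)"
    proof -
      have "u * real j \<in> W" if "k < m" "j \<in> T k" for j k
      proof -
        have "N k > 0" "B k < j" using that(2) by (auto simp: T_def)
        then have "u * real (B k) < u * real j" using u(1) by simp
        moreover have "j \<in> {B k..<B k + N k - 1}" using that(2) by (auto simp: T_def)
        then have "u * real j + u < b k + u * real (N k)" using Bcell[OF that(1)] by blast
        ultimately have "u * real j \<in> I k"
          using B(1)[OF that(1) \<open>N k > 0\<close>] u(1) unfolding I_def greaterThanLessThan_iff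
          by (intro conjI; linarith)
        then show ?thesis using that by (auto simp: W_def)
      qed
      then show ?thesis by auto
    qed
    then have "card {j. j < n \<and> u * real j \<notin> W} \<le> card ({..<n} - (\<Union>k<m. T k))"
      by (intro card_mono) auto
    ultimately show ?thesis by (simp add: G_def)
  qed
  ultimately obtain C' D where CD: "C' \<in> Comms" "D \<in> Comms" "q \<approx>\<^sub>f C' \<circ> D"
    using small_support_Comms[OF qP u, of M W K G] qW m0 unfolding n_def by (auto simp: M_def)
  have "inj (C' \<circ> D)" using PIsoD(2)[OF PIso_comp[OF CD(1,2)[THEN Comms_PIso]]] .
  then have "P \<circ> R \<circ> q \<approx>\<^sub>f P \<circ> R \<circ> (C' \<circ> D)" by (rule fin_eq_comp[OF fin_eq_refl CD(3)])
  then have "g \<approx>\<^sub>f P \<circ> R \<circ> C' \<circ> D" using gq by (simp only: comp_assoc)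
  then show ?thesis using PC RC CD by blast
qed

section \<open>Passing to the quotient group\<close>

lemma isometric_at_isometry:
  assumes X: "connected X" and iso: "X \<inter> breaks f = {}" "x \<in> X" "y \<in> X"
  shows "dist (f x) (f y) = dist x y"
proof -
  obtain s c where "s = 1 \<or> s = -1" "\<And>x. x \<in> X \<Longrightarrow> f x = s * x + c"
    using isometric_at_connected[OF X iso(1)] by blast
  then show ?thesis using iso(2,3) by (auto simp: dist_real_def)
qed

lemma isometry_affine:
  fixes f :: "real \<Rightarrow> real"
  assumes ab: "a < b" and iso: "\<And>x y. x \<in> {a<..<b} \<Longrightarrow> y \<in> {a<..<b} \<Longrightarrow> dist (f x) (f y) = dist x y"
  obtains s c where "s = 1 \<or> s = -1" "\<And>x. x \<in> {a<..<b} \<Longrightarrow> f x = s * x + c"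
proof -
  define p q where "p = a + (b - a) / 3" and "q = a + 2 * (b - a) / 3"
  have pq: "p \<in> {a<..<b}" "q \<in> {a<..<b}" "p < q" using ab by (auto simp: p_def q_def field_simps)
  define s where "s = (f q - f p) / (q - p)"
  have "\<bar>f q - f p\<bar> = q - p" using iso[OF pq(2,1)] pq by (simp add: dist_real_def)
  then have s: "s = 1 \<or> s = -1" using pq by (auto simp: s_def abs_if field_simps split: if_splits)
  have fq: "f q = f p + s * (q - p)" using pq by (simp add: s_def)
  have "f x = s * x + (f p - s * p)" if "x \<in> {a<..<b}" for x
  proof -
    have "\<bar>f x - f p\<bar> = \<bar>x - p\<bar>" "\<bar>f x - f q\<bar> = \<bar>x - q\<bar>"
      using iso[OF that pq(1)] iso[OF that pq(2)] by (auto simp: dist_real_def)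
    then show ?thesis using s fq pq(3) by (auto simp: abs_if split: if_splits)
  qed
  then show ?thesis using that s by blast
qed

lemma PIso_is_FIET:
  assumes "f \<in> PIso" shows "restrict f unit_Ico \<in> carrier FIET_group"
proof -
  have "bij_betw f unit_Ico unit_Ico"
    unfolding bij_betw_def
  proof
    show "inj_on f unit_Ico" using PIsoD(2)[OF assms] by (rule inj_on_subset) simp
    show "f ` unit_Ico = unit_Ico"
    proof (intro equalityI subsetI)
      fix y assume "y \<in> unit_Ico"
      moreover have "y = f (inv f y)" using PIsoD(3)[OF assms] by (simp add: surj_f_inv_f)
      ultimately show "y \<in> f ` unit_Ico" using PIso_mem_iff[OF assms, of "inv f y"] by (metis imageI)
    qed (use PIso_mem_iff[OF assms] in blast)
  qed
  then have bij: "bij_betw (restrict f unit_Ico) unit_Ico unit_Ico" by (simp add: bij_betw_restrict_eq)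
  have "\<exists>S. finite S \<and> (\<forall>x\<in>unit_Ico. \<forall>y\<in>unit_Ico. closed_segment x y \<inter> S = {} \<longrightarrow>
      dist (restrict f unit_Ico x) (restrict f unit_Ico y) = dist x y)"
    using PIsoD(5)[OF assms] isometric_at_isometry[OF connected_segment(1)]
    by (intro exI[of _ "breaks f"]) auto
  with bij have "is_FIET (restrict f unit_Ico)" unfolding is_FIET_iff by blast
  then show ?thesis using bij by (simp add: FIET_group_simps Bij_def)
qed

lemma FIET_extend:
  assumes f: "f \<in> carrier FIET_group"
  shows "\<exists>m a g. g \<in> PIso \<and> restrict g unit_Ico = f \<and> a 0 = 0 \<and> a m = (1::real) \<and>
    (\<forall>k<m. a k < a (Suc k) \<and> (\<exists>s c. (s = 1 \<or> s = -1) \<and> (\<forall>x\<in>{a k<..<a (Suc k)}. g x = s * x + c)))"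
proof -
  have F: "is_FIET f" "f \<in> extensional unit_Ico" "bij_betw f unit_Ico unit_Ico"
    using f by (auto simp: FIET_group_simps Bij_def)
  define g where "g x = (if x \<in> unit_Ico then f x else x)" for x
  from F(1) obtain m and b :: "nat \<Rightarrow> real" where b: "b 1 = 0" "b (m + 1) = 1"
     "\<And>i. i\<in>{1..m} \<Longrightarrow> b i < b (i + 1)"
     "\<And>i x y. i \<in> {1..m} \<Longrightarrow> x\<in>{b i<..<b (i + 1)} \<Longrightarrow> y\<in>{b i<..<b (i + 1)} \<Longrightarrow>
            dist (f x) (f y) = dist x y"
    unfolding is_FIET_def by metis
  define a where "a k = b (Suc k)" for k
  have a: "a 0 = 0" "a m = 1" "\<And>k. k < m \<Longrightarrow> a k < a (Suc k)"
    using b by (auto simp: a_def)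
  have a_mono: "a i \<le> a j" if "i \<le> j" "j \<le> m" for i j
    using subdivision_mono[of m a i j] a(3) that by blast
  have piece: "\<exists>s c. (s = 1 \<or> s = -1) \<and> (\<forall>x\<in>{a k<..<a (Suc k)}. g x = s * x + c)" if k: "k < m" for k
  proof -
    have "dist (f x) (f y) = dist x y" if "x \<in> {a k<..<a (Suc k)}" "y \<in> {a k<..<a (Suc k)}" for x y
      using b(4)[of "Suc k"] k that by (simp add: a_def)
    then obtain s c where "s = 1 \<or> s = -1" "\<And>x. x \<in> {a k<..<a (Suc k)} \<Longrightarrow> f x = s * x + c"
      using isometry_affine[OF a(3)[OF k]] by metis
    moreover have "x \<in> unit_Ico" if "x \<in> {a k<..<a (Suc k)}" for x
      using that a_mono[of 0 k] a_mono[of "Suc k" m] k a by auto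
    ultimately show ?thesis by (metis g_def)
  qed
  have g_out: "g x = x" if "x \<notin> {0..<1}" for x
    unfolding g_def using that by (rule if_not_P)
  have bij: "bij g"
  proof -
    have "bij_betw g unit_Ico unit_Ico"
      using F(3) by (rule bij_betw_cong[THEN iffD1, rotated]) (simp add: g_def)
    moreover have "bij_betw g (- unit_Ico) (- unit_Ico)"
      using bij_betw_id[of "- unit_Ico"]
      by (rule bij_betw_cong[THEN iffD1, rotated]) (simp add: g_out del: atLeastLessThan_iff)
    ultimately have "bij_betw g (unit_Ico \<union> - unit_Ico) (unit_Ico \<union> - unit_Ico)"
      by (rule bij_betw_combine) auto
    then show ?thesis by (simp only: Compl_partition)
  qed
  have "breaks g \<subseteq> a ` {..m}" by (intro breaks_piecewise a piece g_out)
  then have "finite (breaks g)" by (rule finite_subset) simp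
  then have "g \<in> PIso" using bij g_out unfolding PIso_def by blast
  moreover have "restrict g unit_Ico = f" using F(2) by (auto simp: g_def fun_eq_iff extensional_def)
  ultimately show ?thesis using a piece by blast
qed

text \<open>The element of the quotient group represented by a piecewise isometry of the line.\<close>

definition FIET_class :: "(real \<Rightarrow> real) \<Rightarrow> (real \<Rightarrow> real) set" where
  "FIET_class f = FIET_finsupp #>\<^bsub>FIET_group\<^esub> restrict f unit_Ico"

lemma FIET_class_closed: "f \<in> PIso \<Longrightarrow> FIET_class f \<in> carrier FIET_bar"
  using PIso_is_FIET by (auto simp: FIET_class_def FIET_bar_def FactGroup_def RCOSETS_def)

lemma FIET_class_eq: 
  assumes "f \<in> PIso" "g \<in> PIso" "f \<approx>\<^sub>f g" shows "FIET_class f = FIET_class g"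
proof -
  have "finite {x \<in> unit_Ico. restrict f unit_Ico x \<noteq> restrict g unit_Ico x}"
    using assms(3) unfolding fin_eq_def by (rule rev_finite_subset) auto
  then show ?thesis using FIET_coset_eq_iff[OF assms(1,2)[THEN PIso_is_FIET]] by (simp add: FIET_class_def)
qed

lemma FIET_class_comp:
  assumes f: "f \<in> PIso" and g: "g \<in> PIso" shows "FIET_class (f \<circ> g) = FIET_class f \<otimes>\<^bsub>FIET_bar\<^esub> FIET_class g"
proof -
  have "restrict (f \<circ> g) unit_Ico = restrict f unit_Ico \<otimes>\<^bsub>FIET_group\<^esub> restrict g unit_Ico"
    using PIso_mem_iff[OF g] unfolding FIET_group_simps(3)[OF PIso_is_FIET[OF f] PIso_is_FIET[OF g]]
    by (auto simp: compose_def fun_eq_iff)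
  then show ?thesis
    using normal.rcos_sum[OF normal_FIET_finsupp PIso_is_FIET[OF f] PIso_is_FIET[OF g]]
    by (simp add: FIET_class_def FIET_bar_def FactGroup_def)
qed

lemma FIET_class_id: "FIET_class id = \<one>\<^bsub>FIET_bar\<^esub>"
proof -
  interpret group FIET_bar by (rule group_FIET_bar)
  have c: "FIET_class id \<in> carrier FIET_bar" by (rule FIET_class_closed[OF PIso_id])
  have "FIET_class id \<otimes>\<^bsub>FIET_bar\<^esub> FIET_class id = FIET_class id" using FIET_class_comp[of id id] by simp
  then show ?thesis using l_cancel_one[OF c c] by simp
qed

lemma FIET_class_inv:
  assumes "f \<in> PIso" shows "FIET_class (inv f) = m_inv FIET_bar (FIET_class f)"
proof -
  interpret group FIET_bar by (rule group_FIET_bar)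
  have "FIET_class (inv f) \<otimes>\<^bsub>FIET_bar\<^esub> FIET_class f = \<one>\<^bsub>FIET_bar\<^esub>"
    using FIET_class_comp[OF PIso_inv[OF assms] assms] PIsoD(2)[OF assms] by (simp add: FIET_class_id)
  then show ?thesis using FIET_class_closed assms by (intro inv_equality[symmetric]) auto
qed

lemma FIET_class_Comms: "f \<in> Comms \<Longrightarrow> FIET_class f \<in> derived_set FIET_bar (carrier FIET_bar)"
proof -
  assume "f \<in> Comms"
  then obtain a b where ab: "f \<in> PIso" "a \<in> PIso" "b \<in> PIso" "f \<approx>\<^sub>f commut a b"
    by (auto simp: Comms_def)
  have "FIET_class f = FIET_class (commut a b)" using ab by (intro FIET_class_eq) auto
  also have "\<dots> = FIET_class a \<otimes>\<^bsub>FIET_bar\<^esub> FIET_class b \<otimes>\<^bsub>FIET_bar\<^esub> m_inv FIET_bar (FIET_class a) \<otimes>\<^bsub>FIET_bar\<^esub> m_inv FIET_bar (FIET_class b)"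
    unfolding commut_def using ab by (simp add: FIET_class_comp FIET_class_inv PIso_comp PIso_inv del: o_apply)
  finally show ?thesis using FIET_class_closed ab by blast
qed

text \<open>A simultaneous flip of those pieces on which \<open>g\<close> preserves the orientation turns \<open>g\<close> into an exchange that
reverses all its pieces.\<close>

lemma FIET_bar_five_commutators:
  assumes "x \<in> carrier FIET_bar"
  shows "\<exists>f1\<in>Comms. \<exists>f2\<in>Comms. \<exists>f3\<in>Comms. \<exists>f4\<in>Comms. \<exists>f5\<in>Comms. x = FIET_class (f1 \<circ> f2 \<circ> f3 \<circ> f4 \<circ> f5)"
proof -
  obtain f where f: "f \<in> carrier FIET_group" "x = FIET_finsupp #>\<^bsub>FIET_group\<^esub> f"
    using assms by (auto simp: FIET_bar_def FactGroup_def RCOSETS_def)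
  obtain m a g where g: "g \<in> PIso" "restrict g unit_Ico = f" and a: "a 0 = 0" "a m = (1::real)"
    and am: "\<And>k. k < m \<Longrightarrow> a k < a (Suc k)"
    and sc: "\<forall>k<m. \<exists>s c. (s = 1 \<or> s = -1) \<and> (\<forall>x\<in>{a k<..<a (Suc k)}. g x = s * x + c)"
    using FIET_extend[OF f(1)] by metis
  obtain s c where s: "\<And>k. k < m \<Longrightarrow> s k = 1 \<or> s k = -1"
    and c: "\<And>k x. k < m \<Longrightarrow> x \<in> {a k<..<a (Suc k)} \<Longrightarrow> g x = s k * x + c k"
    using sc by metis
  have a_mono: "a i \<le> a j" if "i \<le> j" "j \<le> m" for i j
    using subdivision_mono[of m a i j] am that by blast
  define r where "r k = (if s k = 1 then a (Suc k) else a k)" for k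
  define R where "R = mflip m a r"
  have ra: "r k \<le> a (Suc k)" if "k < m" for k using am[OF that] by (simp add: r_def)
  have dis: "disjoint_family_on (\<lambda>k. {a k<..<r k}) {..<m}"
    unfolding disjoint_family_on_def
  proof (intro ballI impI)
    fix k l assume kl: "k \<in> {..<m}" "l \<in> {..<m}" "k \<noteq> l"
    then consider "Suc k \<le> l" | "Suc l \<le> k" by linarith
    then show "{a k<..<r k} \<inter> {a l<..<r l} = {}"
      using ra[of k] ra[of l] kl a_mono[of "Suc k" l] a_mono[of "Suc l" k] by cases auto
  qed
  have RC: "R \<in> Comms"
    unfolding R_def
  proof (rule mflip_Comms[OF _ dis])
    fix k assume "k < m"
    then show "0 \<le> a k \<and> r k \<le> 1"
      using ra[of k] a a_mono[of 0 k] a_mono[of "Suc k" m] by auto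
  qed
  have RP: "R \<in> PIso" using RC by (rule Comms_PIso)
  have RR: "R \<circ> R = id" unfolding R_def by (rule mflip_mflip[OF dis])
  define e where "e k = (if s k = 1 then a k + a (Suc k) + c k else c k)" for k
  have rev: "(g \<circ> R) x = e k - x" if k: "k < m" and x: "a k < x" "x < a (Suc k)" for k x
  proof (cases "s k = 1")
    case True
    then have rk: "r k = a (Suc k)" by (simp add: r_def)
    then have "R x = a k + a (Suc k) - x" 
      unfolding R_def using mflip_at[OF dis k, of x] x by simp
    then show ?thesis using c[OF k, of "R x"] True x by (simp add: e_def)
  next
    case False
    have "R x = x" unfolding R_def
    proof (rule mflip_outside)
      fix l assume l: "l < m"
      show "x \<notin> {a l<..<r l}"
      proof
        assume xl: "x \<in> {a l<..<r l}"
        then have "l \<noteq> k" using False x by (auto simp: r_def)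
        then consider "Suc k \<le> l" | "Suc l \<le> k" by linarith
        then show False using xl ra[OF l] x k l a_mono[of "Suc k" l] a_mono[of "Suc l" k] by cases auto
      qed
    qed
    then show ?thesis using c[OF k, of x] False s[OF k] x by (simp add: e_def)
  qed
  obtain P Q C D where PQ: "P \<in> Comms" "Q \<in> Comms" "C \<in> Comms" "D \<in> Comms" "g \<circ> R \<approx>\<^sub>f P \<circ> Q \<circ> C \<circ> D"
    using reversing_exchange_Comms[of "g \<circ> R" a m e, OF PIso_comp[OF g(1) RP] a am rev] by blast
  have "g \<circ> R \<circ> R \<approx>\<^sub>f P \<circ> Q \<circ> C \<circ> D \<circ> R" 
    by (rule fin_eq_comp[OF PQ(5) fin_eq_refl PIsoD(2)[OF RP]])
  then have "g \<approx>\<^sub>f P \<circ> Q \<circ> C \<circ> D \<circ> R" unfolding comp_assoc RR by simp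
  then have "FIET_class g = FIET_class (P \<circ> Q \<circ> C \<circ> D \<circ> R)"
    using PQ(1-4)[THEN Comms_PIso] RP g(1) by (intro FIET_class_eq PIso_comp)
  moreover have "x = FIET_class g" using f g by (simp add: FIET_class_def)
  ultimately show ?thesis using PQ RC by blast
qed

theorem theorem1:
  shows "commutator_width FIET_bar \<le> 6"
  unfolding commutator_width_def
proof (rule SUP_least)
  interpret group FIET_bar by (rule group_FIET_bar)
  fix x assume "x \<in> derived FIET_bar (carrier FIET_bar)"
  then have "x \<in> carrier FIET_bar" using derived_in_carrier[of "carrier FIET_bar"] by blast
  then obtain f1 f2 f3 f4 f5 where f: "f1 \<in> Comms" "f2 \<in> Comms" "f3 \<in> Comms" "f4 \<in> Comms" "f5 \<in> Comms"
    and x: "x = FIET_class (f1 \<circ> f2 \<circ> f3 \<circ> f4 \<circ> f5)"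
    using FIET_bar_five_commutators by blast
  define cs where "cs = map FIET_class [f1, f2, f3, f4, f5]"
  have P: "f1 \<in> PIso" "f2 \<in> PIso" "f3 \<in> PIso" "f4 \<in> PIso" "f5 \<in> PIso" using f by (auto intro: Comms_PIso)
  have "x = foldr (\<otimes>\<^bsub>FIET_bar\<^esub>) cs \<one>\<^bsub>FIET_bar\<^esub>"
  proof -
    have c: "FIET_class f \<in> carrier FIET_bar" if "f \<in> PIso" for f using that by (rule FIET_class_closed)
    have "x = FIET_class f1 \<otimes>\<^bsub>FIET_bar\<^esub> FIET_class f2 \<otimes>\<^bsub>FIET_bar\<^esub> FIET_class f3 \<otimes>\<^bsub>FIET_bar\<^esub> FIET_class f4 \<otimes>\<^bsub>FIET_bar\<^esub> FIET_class f5"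
      unfolding x using P by (simp only: FIET_class_comp PIso_comp)
    then show ?thesis unfolding cs_def using P c by (simp add: m_assoc)
  qed
  moreover have "set cs \<subseteq> derived_set FIET_bar (carrier FIET_bar)"
    using FIET_class_Comms f by (auto simp only: cs_def list.map list.set)
  ultimately have "commutator_length FIET_bar x \<le> enat (length cs)"
    unfolding commutator_length_def by (intro Inf_lower) blast
  also have "\<dots> \<le> 6" by (simp add: cs_def numeral_eq_enat)
  finally show "commutator_length FIET_bar x \<le> 6" .
qed

end
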